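(* Let $q\in(0,1)$ and $r>0$, let $\mathbb{A}_q=\{z\in\mathbb{C}: q<|z|<1\}$, let $X_{\mathbb{A}_q}^r$ be the i.i.d. Gaussian Laurent series on $\mathbb{A}_q$ with weight parameter $r$ and $\mathcal{Z}_{X_{\mathbb{A}_q}^r}$ its zero point process (see context). Let $T_q(z):=q/z$, so that $T_q'(z)=-q/z^2$. (i) The GAF $X_{\mathbb{A}_q}^r$ has the $(q,r)$-inversion symmetry: as random processes indexed by $z\in\mathbb{A}_q$, $$\Big\{(T_q'(z))^{1/2}X_{\mathbb{A}_q}^r(T_q(z))\Big\}_{z\in\mathbb{A}_q}\stackrel{\mathrm{d}}{=}\Big\{\sqrt{\tfrac{q}{r}}\,X_{\mathbb{A}_q}^{q^2/r}(z)\Big\}_{z\in\mathbb{A}_q}.$$ (ii) Writing $\mathcal{Z}_{X_{\mathbb{A}_q}^r}=\sum_i\delta_{Z_i}$ and $T_q^*\mathcal{Z}_{X_{\mathbb{A}_q}^r}:=\sum_i\delta_{T_q^{-1}(Z_i)}$, we have $T_q^*\mathcal{Z}_{X_{\mathbb{A}_q}^r}\stackrel{\mathrm{d}}{=}\mathcal{Z}_{X_{\mathbb{A}_q}^{q^2/r}}$. (iii) In particular, when $r=q$, the GAF $X_{\mathbb{A}_q}:=X_{\mathbb{A}_q}^q$ is invariant under conformal transformations which preserve $\mathbb{A}_q$, and so is its zero point process $\mathcal{Z}_{X_{\mathbb{A}_q}}$.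
   Context: Let $\{\zeta_n\}_{n\in\mathbb{Z}}$ be i.i.d. standard complex Gaussian random variables with density $e^{-|z|^2}/\pi$. For $r>0$ define $$X_{\mathbb{A}_q}^r(z)=\sum_{n=-\infty}^{\infty}\zeta_n\frac{z^n}{\sqrt{1+rq^{2n}}},\quad z\in\mathbb{A}_q,$$ which a.s. converges on $\mathbb{A}_q$ and is a centered Gaussian analytic function (GAF) with covariance kernel $\mathbf{E}[X_{\mathbb{A}_q}^r(z)\overline{X_{\mathbb{A}_q}^r(w)}]=S_{\mathbb{A}_q}(z,w;r):=\sum_{n\in\mathbb{Z}}\frac{(z\overline{w})^n}{1+rq^{2n}}$. Its zero point process is $\mathcal{Z}_{X_{\mathbb{A}_q}^r}=\sum_{z\in\mathbb{A}_q:X_{\mathbb{A}_q}^r(z)=0}\delta_z$. The symbol $\stackrel{\mathrm{d}}{=}$ is equality in law, and $(T_q'(z))^{1/2}=\sqrt{-1}\,q^{1/2}/z$ is a single-valued square root on $\mathbb{A}_q$. A conformal transformation preserving $\mathbb{A}_q$ is a bijective holomorphic map $f:\mathbb{A}_q\to\mathbb{A}_q$ (by Schottky's theorem these are generated by rotations and $T_q$). Invariance of a GAF $X$ under such an $f$ means $\{(f'(z))^{1/2}X(f(z))\}_{z\in\mathbb{A}_q}\stackrel{\mathrm{d}}{=}\{X(z)\}_{z\in\mathbb{A}_q}$ (with a single-valued branch of $(f')^{1/2}$), and invariance of a point process $\sum_i\delta_{Z_i}$ means $\sum_i\delta_{f^{-1}(Z_i)}\stackrel{\mathrm{d}}{=}\sum_i\delta_{Z_i}$.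 *)

theory Defs
  imports "HOL-Probability.Probability"
begin

definition annulus :: "real \<Rightarrow> complex set" where
  "annulus q = {z. q < cmod z \<and> cmod z < 1}"

definition iid_std_complex_gaussian :: "'a measure \<Rightarrow> (int \<Rightarrow> 'a \<Rightarrow> complex) \<Rightarrow> bool" where
  "iid_std_complex_gaussian M \<zeta> \<longleftrightarrow>
     prob_space M \<and> prob_space.indep_vars M (\<lambda>_. borel) \<zeta> UNIV \<and>
     (\<forall>n. distributed M lborel (\<zeta> n) (\<lambda>z. ennreal (exp (- (cmod z)\<^sup>2) / pi)))"

definition laurent_term ::
    "real \<Rightarrow> real \<Rightarrow> (int \<Rightarrow> 'a \<Rightarrow> complex) \<Rightarrow> 'a \<Rightarrow> complex \<Rightarrow> int \<Rightarrow> complex" where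
  "laurent_term q r \<zeta> \<omega> z n =
     \<zeta> n \<omega> * (z powi n / complex_of_real (sqrt (1 + r * q powi (2 * n))))"

text \<open>The series converges on the whole annulus only almost surely. On the exceptional null event
  every path is set to the zero function. At points of the open annulus, a Laurent series that
  converges throughout the annulus converges absolutely, so unconditional summability is the
  usual notion of convergence here.\<close>

definition gaussian_laurent ::
    "real \<Rightarrow> real \<Rightarrow> (int \<Rightarrow> 'a \<Rightarrow> complex) \<Rightarrow> 'a \<Rightarrow> complex \<Rightarrow> complex" where
  "gaussian_laurent q r \<zeta> \<omega> z =
     (if \<forall>w\<in>annulus q. laurent_term q r \<zeta> \<omega> w summable_on UNIV
      then \<Sum>\<^sub>\<infinity>n. laurent_term q r \<zeta> \<omega> z n else 0)"

text \<open>\<^const>\<open>distr\<close> is meaningful only for measurable maps, so equality in law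
  includes the measurability of both random elements.\<close>

definition same_law :: "'a measure \<Rightarrow> 'b measure \<Rightarrow> ('a \<Rightarrow> 'b) \<Rightarrow> ('a \<Rightarrow> 'b) \<Rightarrow> bool" where
  "same_law M N X Y \<longleftrightarrow>
     X \<in> measurable M N \<and> Y \<in> measurable M N \<and> distr M N X = distr M N Y"

definition same_law_process ::
    "'a measure \<Rightarrow> complex set \<Rightarrow> ('a \<Rightarrow> complex \<Rightarrow> complex) \<Rightarrow> ('a \<Rightarrow> complex \<Rightarrow> complex) \<Rightarrow> bool" where
  "same_law_process M A X Y \<longleftrightarrow>
     same_law M (\<Pi>\<^sub>M z\<in>A. borel) (\<lambda>\<omega>. restrict (X \<omega>) A) (\<lambda>\<omega>. restrict (Y \<omega>) A)"

text \<open>The measurable space of all measures on \<open>K\<close>, with the \<open>\<sigma>\<close>-algebra generated by the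
  evaluations \<open>N \<mapsto> N(B)\<close>; compare \<^const>\<open>subprob_algebra\<close>.\<close>

definition measure_algebra :: "'b measure \<Rightarrow> 'b measure measure" where
  "measure_algebra K =
     (SUP B\<in>sets K. vimage_algebra {N. sets N = sets K} (\<lambda>N. emeasure N B) borel)"

definition same_law_point_process ::
    "'a measure \<Rightarrow> complex set \<Rightarrow> ('a \<Rightarrow> complex measure) \<Rightarrow> ('a \<Rightarrow> complex measure) \<Rightarrow> bool" where
  "same_law_point_process M A Z W \<longleftrightarrow>
     same_law M (measure_algebra (restrict_space borel A)) Z W"

text \<open>The measure \<open>\<Sum>z\<in>A, F z = 0. \<delta>\<^sub>z\<close> on the Borel sets of \<open>A\<close>: every zero has mass one.\<close>

definition zero_measure :: "complex set \<Rightarrow> (complex \<Rightarrow> complex) \<Rightarrow> complex measure" where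
  "zero_measure A F = distr (count_space {z\<in>A. F z = 0}) (restrict_space borel A) (\<lambda>z. z)"

lemma emeasure_zero_measure:
  assumes "B \<in> sets (restrict_space borel A)"
  shows "emeasure (zero_measure A F) B = emeasure (count_space UNIV) {z\<in>B. F z = 0}"
proof -
  have BA: "B \<subseteq> A"
    using sets.sets_into_space[OF assms] by (auto simp: space_restrict_space)
  have "emeasure (zero_measure A F) B
      = emeasure (count_space {z\<in>A. F z = 0}) ((\<lambda>z. z) -` B \<inter> {z\<in>A. F z = 0})"
    unfolding zero_measure_def using assms
    by (subst emeasure_distr) (auto simp: space_restrict_space)
  also have "(\<lambda>z. z) -` B \<inter> {z\<in>A. F z = 0} = {z\<in>B. F z = 0}"
    using BA by auto
  also have "emeasure (count_space {z\<in>A. F z = 0}) \<dots> = emeasure (count_space UNIV) \<dots>"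
    using BA by (simp add: emeasure_count_space subset_iff)
  finally show ?thesis .
qed

text \<open>\<open>\<Sum>\<^sub>i \<delta>\<^bsub>Z\<^sub>i\<^esub>\<close> becomes \<open>\<Sum>\<^sub>i \<delta>\<^bsub>f\<^sup>-\<^sup>1(Z\<^sub>i)\<^esub>\<close>, the image measure under the inverse of \<open>f\<close> on \<open>A\<close>.\<close>

definition pullback_measure ::
    "complex set \<Rightarrow> (complex \<Rightarrow> complex) \<Rightarrow> complex measure \<Rightarrow> complex measure" where
  "pullback_measure A f N = distr N (restrict_space borel A) (inv_into A f)"

definition inversion :: "real \<Rightarrow> complex \<Rightarrow> complex" where
  "inversion q z = complex_of_real q / z"

definition inversion_deriv_sqrt :: "real \<Rightarrow> complex \<Rightarrow> complex" where
  "inversion_deriv_sqrt q z = \<i> * complex_of_real (sqrt q) / z"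

definition deriv_sqrt_branch :: "complex set \<Rightarrow> (complex \<Rightarrow> complex) \<Rightarrow> (complex \<Rightarrow> complex) \<Rightarrow> bool" where
  "deriv_sqrt_branch A f g \<longleftrightarrow> g holomorphic_on A \<and> (\<forall>z\<in>A. (g z)\<^sup>2 = deriv f z)"

lemma deriv_sqrt_branch_inversion:
  assumes "0 < q"
  shows "deriv_sqrt_branch (annulus q) (inversion q) (inversion_deriv_sqrt q)"
proof -
  have nz: "z \<noteq> 0" if "z \<in> annulus q" for z
    using that assms by (auto simp: annulus_def)
  have "(inversion_deriv_sqrt q z)\<^sup>2 = deriv (inversion q) z" if z: "z \<in> annulus q" for z
  proof -
    have "(inversion q has_field_derivative - complex_of_real q / z\<^sup>2) (at z)"
      unfolding inversion_def using nz[OF z]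
      by (auto intro!: derivative_eq_intros simp: power2_eq_square)
    then have "deriv (inversion q) z = - complex_of_real q / z\<^sup>2"
      by (rule DERIV_imp_deriv)
    moreover have "(complex_of_real (sqrt q))\<^sup>2 = complex_of_real q"
      using assms by (simp flip: of_real_power)
    ultimately show ?thesis
      by (simp add: inversion_deriv_sqrt_def power_mult_distrib power_divide)
  qed
  moreover have "inversion_deriv_sqrt q holomorphic_on annulus q"
    unfolding inversion_deriv_sqrt_def using nz by (auto intro!: holomorphic_intros)
  ultimately show ?thesis
    by (auto simp: deriv_sqrt_branch_def)
qed

definition conformal_automorphism :: "complex set \<Rightarrow> (complex \<Rightarrow> complex) \<Rightarrow> bool" where
  "conformal_automorphism A f \<longleftrightarrow> f holomorphic_on A \<and> bij_betw f A A"

text \<open>A single-valued branch is required to exist, and the equality in law is required of every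
  such branch.\<close>

definition invariant_GAF ::
    "'a measure \<Rightarrow> complex set \<Rightarrow> ('a \<Rightarrow> complex \<Rightarrow> complex) \<Rightarrow> (complex \<Rightarrow> complex) \<Rightarrow> bool" where
  "invariant_GAF M A X f \<longleftrightarrow>
     (\<exists>g. deriv_sqrt_branch A f g) \<and>
     (\<forall>g. deriv_sqrt_branch A f g \<longrightarrow> same_law_process M A (\<lambda>\<omega> z. g z * X \<omega> (f z)) X)"

definition invariant_point_process ::
    "'a measure \<Rightarrow> complex set \<Rightarrow> ('a \<Rightarrow> complex measure) \<Rightarrow> (complex \<Rightarrow> complex) \<Rightarrow> bool" where
  "invariant_point_process M A Z f \<longleftrightarrow>
     same_law_point_process M A (\<lambda>\<omega>. pullback_measure A f (Z \<omega>)) Z"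

definition zero_process ::
    "real \<Rightarrow> real \<Rightarrow> (int \<Rightarrow> 'a \<Rightarrow> complex) \<Rightarrow> 'a \<Rightarrow> complex measure" where
  "zero_process q r \<zeta> \<omega> = zero_measure (annulus q) (gaussian_laurent q r \<zeta> \<omega>)"

end

theory Submission
  imports Defs "HOL-Complex_Analysis.Complex_Analysis"
begin

text \<open>Reindexing the Laurent series by \<open>n \<mapsto> -n - 1\<close> turns \<open>(T\<^sub>q'(z))\<^sup>1\<^sup>/\<^sup>2 X(T\<^sub>q(z))\<close> into
  \<open>\<surd>(q/r)\<close> times the series with parameter \<open>q\<^sup>2/r\<close> and coefficients \<open>\<i> \<zeta>\<^bsub>-n-1\<^esub>\<close>, for every
  outcome and not merely almost surely. These coefficients are again i.i.d. standard complex Gaussian,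
  so every measurable functional of the coefficient sequence, in particular the path and its zero
  measure, keeps its law. Rotations act in the same way through the coefficients \<open>s c\<^sup>n \<zeta>\<^sub>n\<close> with
  unimodular \<open>s\<close> and \<open>c\<close>. By the maximum principle, an automorphism of the annulus is a rotation or a
  rotation composed with the inversion.\<close>

section \<open>Invariance of the law of the coefficients\<close>

text \<open>The root of the derivative contributes a factor 1/z, so the term of index m in X(q/z)
  carries the power z^(-m-1); this fixes the shift n = -m-1. Pulling r q^(2m) out of 1 + r q^(2m)
  leaves 1 + (q^2/r) q^(2n), whence the new parameter. The map r -> q^2/r is an involution of the
  positive reals whose only fixed point is r = q, which singles out the conformally invariant case.
  The obstacle is measurability: the zero measure must be a measurable function on the whole space
  of coefficient sequences. This includes sequences with a divergent series; their path is 0, and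
  its zero measure is the counting measure of the annulus, which is not sigma-finite. The zero path
  is therefore split off before counts are subtracted. Automorphisms come without boundary values;
  properness replaces an extension to the boundary.\<close>

lemma nn_integral_lborel_translate:
  fixes f :: "'a::euclidean_space \<Rightarrow> ennreal"
  assumes [measurable]: "f \<in> borel_measurable borel"
  shows "(\<integral>\<^sup>+x. f (x + t) \<partial>lborel) = (\<integral>\<^sup>+x. f x \<partial>lborel)"
  by (subst (2) lborel_distr_plus[of t, symmetric]) (simp add: nn_integral_distr add.commute)

lemma nn_integral_lborel_reflect:
  fixes f :: "'a::euclidean_space \<Rightarrow> ennreal"
  assumes [measurable]: "f \<in> borel_measurable borel"
  shows "(\<integral>\<^sup>+x. f (t - x) \<partial>lborel) = (\<integral>\<^sup>+x. f x \<partial>lborel)"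
  by (subst (2) lborel_affine[of "-1" t]) (simp_all add: nn_integral_distr density_1)

text \<open>Lebesgue measure and its rotated copy are both translation invariant, hence proportional;
  the factor is \<open>1\<close> because the unit ball is invariant. Fubini on
  \<open>\<integral>\<integral> 1\<^sub>A(c x) 1\<^sub>B(c x + y)\<close> makes this explicit.\<close>

lemma lborel_distr_rotation:
  fixes c :: complex
  assumes c: "cmod c = 1"
  shows "distr lborel borel (\<lambda>z. c * z) = lborel"
proof (rule measure_eqI)
  fix A assume "A \<in> sets (distr lborel borel (\<lambda>z. c * z))"
  then have A[measurable]: "A \<in> sets borel" by simp
  define B where "B = ball (0::complex) 1"
  have B[measurable]: "B \<in> sets borel" by (simp add: B_def)
  have c0: "c \<noteq> 0" using c by auto
  have Bc: "indicator B (c * x) = (indicator B x :: ennreal)" for x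
    using c by (simp add: B_def indicator_def norm_mult)
  let ?I = "\<integral>\<^sup>+x. (\<integral>\<^sup>+y. indicator A (c * x) * indicator B (c * x + y) \<partial>lborel) \<partial>lborel :: ennreal"
  have "?I = (\<integral>\<^sup>+x. indicator A (c * x) * emeasure lborel B \<partial>lborel)"
  proof (rule nn_integral_cong)
    fix x
    have "(\<integral>\<^sup>+y. indicator A (c * x) * indicator B (c * x + y) \<partial>lborel)
        = indicator A (c * x) * (\<integral>\<^sup>+y. indicator B (y + c * x) \<partial>lborel)"
      by (subst nn_integral_cmult) (auto simp: add.commute)
    also have "(\<integral>\<^sup>+y. indicator B (y + c * x) \<partial>lborel) = emeasure lborel B"
      by (subst nn_integral_lborel_translate) auto
    finally show "(\<integral>\<^sup>+y. indicator A (c * x) * indicator B (c * x + y) \<partial>lborel)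
        = (indicator A (c * x) * emeasure lborel B :: ennreal)" .
  qed
  also have "\<dots> = (\<integral>\<^sup>+x. indicator A (c * x) \<partial>lborel) * emeasure lborel B"
    by (rule nn_integral_multc) measurable
  also have "(\<integral>\<^sup>+x. indicator A (c * x) \<partial>lborel) = emeasure (distr lborel borel (\<lambda>z. c * z)) A"
    by (simp add: nn_integral_distr flip: nn_integral_indicator)
  finally have I1: "?I = emeasure (distr lborel borel (\<lambda>z. c * z)) A * emeasure lborel B" .
  have "?I = (\<integral>\<^sup>+y. (\<integral>\<^sup>+x. indicator A (c * x) * indicator B (c * x + y) \<partial>lborel) \<partial>lborel)"
    by (rule lborel_pair.Fubini'[symmetric]) measurable
  also have "\<dots> = (\<integral>\<^sup>+y. (\<integral>\<^sup>+x. indicator A (c * x - y) * indicator B (c * x) \<partial>lborel) \<partial>lborel)"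
  proof (rule nn_integral_cong)
    fix y
    \<comment> \<open>Replacing x by x - y / c moves the shift from \<open>B\<close> to
      \<open>A\<close>; integrating over y first then yields the volume of \<open>A\<close> with no
      trace of \<open>c\<close>.\<close>
    show "(\<integral>\<^sup>+x. indicator A (c * x) * indicator B (c * x + y) \<partial>lborel)
        = (\<integral>\<^sup>+x. indicator A (c * x - y) * indicator B (c * x) \<partial>lborel :: ennreal)"
      using c0
      by (subst nn_integral_lborel_translate[where t = "- y / c", symmetric])
         (auto simp: right_diff_distrib)
  qed
  also have "\<dots> = (\<integral>\<^sup>+x. (\<integral>\<^sup>+y. indicator A (c * x - y) * indicator B (c * x) \<partial>lborel) \<partial>lborel)"
    by (rule lborel_pair.Fubini') measurable
  also have "\<dots> = (\<integral>\<^sup>+x. emeasure lborel A * indicator B (c * x) \<partial>lborel)"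
  proof (rule nn_integral_cong)
    fix x
    have "(\<integral>\<^sup>+y. indicator A (c * x - y) * indicator B (c * x) \<partial>lborel)
       = (\<integral>\<^sup>+y. indicator A (c * x - y) \<partial>lborel) * (indicator B (c * x) :: ennreal)"
      by (rule nn_integral_multc) measurable
    then show "(\<integral>\<^sup>+y. indicator A (c * x - y) * indicator B (c * x) \<partial>lborel)
       = emeasure lborel A * (indicator B (c * x) :: ennreal)"
      by (simp add: nn_integral_lborel_reflect)
  qed
  also have "\<dots> = emeasure lborel A * emeasure lborel B"
    by (simp add: Bc nn_integral_cmult)
  finally have I2: "?I = emeasure lborel A * emeasure lborel B" .
  have "emeasure lborel B \<noteq> 0"
    using content_ball_pos[of 1 "0::complex"] by (auto simp: B_def measure_def)
  moreover have "emeasure lborel B \<noteq> \<infinity>"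
    using emeasure_lborel_ball_finite[of "0::complex" 1] by (simp add: B_def)
  ultimately show "emeasure (distr lborel borel (\<lambda>z. c * z)) A = emeasure lborel A"
    using I1 I2 by (simp add: mult.commute[of _ "emeasure lborel B"] ennreal_mult_cancel_left)
qed simp

lemma density_lborel_rotation:
  fixes f :: "complex \<Rightarrow> ennreal"
  assumes [measurable]: "f \<in> borel_measurable borel"
    and f: "\<And>z. f (c * z) = f z" and c: "cmod c = 1"
  shows "distr (density lborel f) borel (\<lambda>z. c * z) = density lborel f"
proof -
  \<comment> \<open>Invariance is used backwards: f(z) is written as f(c z), the form in which a
    density passes through an image measure.\<close>
  have "distr (density lborel f) borel (\<lambda>z. c * z)
      = distr (density lborel (\<lambda>z. f (c * z))) borel (\<lambda>z. c * z)"
    by (simp add: f)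
  also have "\<dots> = density (distr lborel borel (\<lambda>z. c * z)) f"
    by (rule density_distr[symmetric]) measurable
  also have "\<dots> = density lborel f"
    by (simp add: lborel_distr_rotation[OF c])
  finally show ?thesis .
qed

text \<open>The right side mentions neither \<open>M\<close> nor \<open>\<zeta>\<close>: all i.i.d.
  standard Gaussian families share one law on sequence space.\<close>

lemma iid_std_complex_gaussian_law:
  assumes "iid_std_complex_gaussian M \<zeta>"
  shows "distr M (\<Pi>\<^sub>M n\<in>UNIV. borel) (\<lambda>\<omega> n. \<zeta> n \<omega>)
       = (\<Pi>\<^sub>M n\<in>UNIV. density lborel (\<lambda>z. ennreal (exp (- (cmod z)\<^sup>2) / pi)))"
proof -
  interpret prob_space M using assms by (simp add: iid_std_complex_gaussian_def)
  have d: "distributed M lborel (\<zeta> n) (\<lambda>z. ennreal (exp (- (cmod z)\<^sup>2) / pi))" for n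
    using assms by (simp add: iid_std_complex_gaussian_def)
  have [measurable]: "\<zeta> n \<in> borel_measurable M" for n
    using distributed_measurable[OF d[of n]] by simp
  have "distr M borel (\<zeta> n) = density lborel (\<lambda>z. ennreal (exp (- (cmod z)\<^sup>2) / pi))" for n
    using distributed_distr_eq_density[OF d[of n]] by (metis distr_cong sets_lborel)
  moreover have "indep_vars (\<lambda>_. borel) \<zeta> UNIV"
    using assms by (simp add: iid_std_complex_gaussian_def)
  ultimately show ?thesis
    by (subst (asm) indep_vars_iff_distr_eq_PiM) (auto simp: restrict_UNIV)
qed

text \<open>Independence says that the joint law is the product of the marginals, and selecting
  coordinates of a product measure along an injection gives a product measure. A repeated index
  would repeat a variable, hence injectivity.\<close>

lemma (in prob_space) indep_vars_inj_reindex: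
  assumes ind: "indep_vars (\<lambda>_. N) X UNIV" and \<sigma>: "inj \<sigma>"
  shows "indep_vars (\<lambda>_. N) (X \<circ> \<sigma>) UNIV"
proof -
  have X[measurable]: "X n \<in> M \<rightarrow>\<^sub>M N" for n
    using ind by (simp add: indep_vars_def)
  have prob: "prob_space (distr M N (X n))" for n
    by (rule prob_space_distr) simp
  have law: "distr M (\<Pi>\<^sub>M n\<in>UNIV. N) (\<lambda>\<omega>. \<lambda>n\<in>UNIV. X n \<omega>) = (\<Pi>\<^sub>M n\<in>UNIV. distr M N (X n))"
    using ind by (subst (asm) indep_vars_iff_distr_eq_PiM) auto
  have "distr M (\<Pi>\<^sub>M n\<in>UNIV. N) (\<lambda>\<omega>. \<lambda>n\<in>UNIV. (X \<circ> \<sigma>) n \<omega>)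
      = distr (distr M (\<Pi>\<^sub>M n\<in>UNIV. N) (\<lambda>\<omega>. \<lambda>n\<in>UNIV. X n \<omega>)) (\<Pi>\<^sub>M n\<in>UNIV. N) (\<lambda>x. \<lambda>n\<in>UNIV. x (\<sigma> n))"
    by (subst distr_distr) (auto simp: comp_def)
  also have "\<dots> = distr (\<Pi>\<^sub>M n\<in>UNIV. distr M N (X n)) (\<Pi>\<^sub>M n\<in>UNIV. distr M N (X (\<sigma> n))) (\<lambda>x. \<lambda>n\<in>UNIV. x (\<sigma> n))"
    unfolding law by (intro distr_cong refl sets_PiM_cong) auto
  also have "\<dots> = (\<Pi>\<^sub>M n\<in>UNIV. distr M N (X (\<sigma> n)))"
    by (rule distr_PiM_reindex) (use prob \<sigma> in auto)
  finally show ?thesis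
    by (subst indep_vars_iff_distr_eq_PiM) (auto simp: comp_def)
qed

text \<open>Independence survives injective reindexing and coordinatewise maps; each marginal
  survives because the density depends on the modulus only.\<close>

lemma iid_std_complex_gaussian_reindex:
  assumes iid: "iid_std_complex_gaussian M \<zeta>" and \<sigma>: "inj \<sigma>" and c: "\<And>n. cmod (c n) = 1"
  shows "iid_std_complex_gaussian M (\<lambda>n \<omega>. c n * \<zeta> (\<sigma> n) \<omega>)"
  unfolding iid_std_complex_gaussian_def
proof (intro conjI allI)
  show "prob_space M" using iid by (simp add: iid_std_complex_gaussian_def)
  interpret prob_space M by fact
  have "indep_vars (\<lambda>_. borel) \<zeta> UNIV"
    using iid by (simp add: iid_std_complex_gaussian_def)
  then have "indep_vars (\<lambda>_. borel) (\<zeta> \<circ> \<sigma>) UNIV"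
    by (rule indep_vars_inj_reindex) (rule \<sigma>)
  then show "indep_vars (\<lambda>_. borel) (\<lambda>n \<omega>. c n * \<zeta> (\<sigma> n) \<omega>) UNIV"
    using indep_vars_compose2[of "\<lambda>_. borel" "\<zeta> \<circ> \<sigma>" UNIV "\<lambda>n z. c n * z" "\<lambda>_. borel"]
    by (simp add: comp_def)
  fix n
  let ?f = "\<lambda>z::complex. ennreal (exp (- (cmod z)\<^sup>2) / pi)"
  have d: "distributed M lborel (\<zeta> (\<sigma> n)) ?f"
    using iid by (simp add: iid_std_complex_gaussian_def)
  have [measurable]: "\<zeta> (\<sigma> n) \<in> borel_measurable M"
    using distributed_measurable[OF d] by simp
  have "distr M lborel (\<lambda>\<omega>. c n * \<zeta> (\<sigma> n) \<omega>) = distr (distr M lborel (\<zeta> (\<sigma> n))) borel (\<lambda>z. c n * z)"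
    by (subst distr_distr) (auto simp: comp_def intro!: distr_cong)
  also have "\<dots> = density lborel ?f"
    unfolding distributed_distr_eq_density[OF d]
    by (rule density_lborel_rotation) (auto simp: norm_mult c)
  finally show "distributed M lborel (\<lambda>\<omega>. c n * \<zeta> (\<sigma> n) \<omega>) ?f"
    by (simp add: distributed_def)
qed

text \<open>Both laws are images under \<open>\<Phi>\<close> of the same product measure, however
  the two families depend on each other.\<close>

lemma same_law_iid_std_complex_gaussian:
  assumes "iid_std_complex_gaussian M \<zeta>" "iid_std_complex_gaussian M \<xi>"
    and \<Phi>: "\<Phi> \<in> (\<Pi>\<^sub>M n\<in>UNIV. borel) \<rightarrow>\<^sub>M N"
  shows "same_law M N (\<lambda>\<omega>. \<Phi> (\<lambda>n. \<zeta> n \<omega>)) (\<lambda>\<omega>. \<Phi> (\<lambda>n. \<xi> n \<omega>))"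
proof -
  have meas: "(\<lambda>\<omega> n. \<eta> n \<omega>) \<in> M \<rightarrow>\<^sub>M (\<Pi>\<^sub>M n\<in>UNIV. borel)"
    if "iid_std_complex_gaussian M \<eta>" for \<eta> :: "int \<Rightarrow> 'a \<Rightarrow> complex"
  proof -
    have "\<eta> n \<in> borel_measurable M" for n
      using that by (auto simp: iid_std_complex_gaussian_def distributed_def)
    then show ?thesis
      by (intro measurable_PiM_single') (auto simp: PiE_def)
  qed
  have "distr M N (\<lambda>\<omega>. \<Phi> (\<lambda>n. \<eta> n \<omega>))
      = distr (\<Pi>\<^sub>M n\<in>UNIV. density lborel (\<lambda>z. ennreal (exp (- (cmod z)\<^sup>2) / pi))) N \<Phi>"
    if "iid_std_complex_gaussian M \<eta>" for \<eta> :: "int \<Rightarrow> 'a \<Rightarrow> complex"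
    unfolding iid_std_complex_gaussian_law[OF that, symmetric]
    by (subst distr_distr[OF \<Phi> meas[OF that]]) (simp add: comp_def)
  then show ?thesis
    unfolding same_law_def
    using assms meas by (auto intro: measurable_compose[OF _ \<Phi>])
qed

section \<open>Measurability of the zeros of a random analytic function\<close>

lemma measurable_measure_algebra:
  assumes "\<And>x. x \<in> space M \<Longrightarrow> sets (N x) = sets K"
    and "\<And>B. B \<in> sets K \<Longrightarrow> (\<lambda>x. emeasure (N x) B) \<in> borel_measurable M"
  shows "N \<in> M \<rightarrow>\<^sub>M measure_algebra K"
  unfolding measure_algebra_def
  by (rule measurable_SUP2) (use assms in \<open>auto intro!: measurable_vimage_algebra2\<close>)

lemma sets_zero_measure: "sets (zero_measure A F) = sets (restrict_space borel A)"
  by (simp add: zero_measure_def)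

lemma zero_measure_cong:
  assumes "\<And>z. z \<in> A \<Longrightarrow> F z = 0 \<longleftrightarrow> G z = 0"
  shows "zero_measure A F = zero_measure A G"
proof -
  have "{z\<in>A. F z = 0} = {z\<in>A. G z = 0}" using assms by auto
  then show ?thesis by (simp add: zero_measure_def)
qed

text \<open>The inverse of \<open>f\<close> carries a zero w of \<open>F\<close> to a zero of z ->
  F(f z), and a bijection preserves cardinality. Continuity of the inverse supplies the Borel
  measurability that gives the image measure its meaning.\<close>

lemma pullback_zero_measure:
  assumes bij: "bij_betw f A A" and cont: "continuous_on A (inv_into A f)" 
  shows "pullback_measure A f (zero_measure A F) = zero_measure A (\<lambda>z. F (f z))"
proof (rule measure_eqI)
  let ?R = "restrict_space borel A"
  fix B assume "B \<in> sets (pullback_measure A f (zero_measure A F))"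
  then have B: "B \<in> sets ?R" by (simp add: pullback_measure_def)
  then have BA: "B \<subseteq> A" using sets.sets_into_space by (fastforce simp: space_restrict_space)
  have inv: "inv_into A f \<in> A \<rightarrow> A"
    using bij_betw_inv_into[OF bij] by (auto simp: bij_betw_def)
  have g: "inv_into A f \<in> ?R \<rightarrow>\<^sub>M ?R"
    using borel_measurable_continuous_on_restrict[OF cont] inv
    by (simp add: measurable_restrict_space2_iff space_restrict_space)
  have sp: "space (zero_measure A F) = A"
    using sets_eq_imp_space_eq[OF sets_zero_measure] by (simp add: space_restrict_space)
  have g': "inv_into A f \<in> zero_measure A F \<rightarrow>\<^sub>M ?R"
    using g by (simp add: measurable_cong_sets[OF sets_zero_measure refl])
  have *: "inv_into A f -` B \<inter> A \<in> sets ?R"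
    using measurable_sets[OF g B] by (simp add: space_restrict_space)
  have "emeasure (pullback_measure A f (zero_measure A F)) B
      = emeasure (zero_measure A F) (inv_into A f -` B \<inter> A)"
    unfolding pullback_measure_def by (subst emeasure_distr[OF g' B]) (simp add: sp)
  also have "\<dots> = emeasure (count_space UNIV) {w \<in> inv_into A f -` B \<inter> A. F w = 0}"
    by (rule emeasure_zero_measure[OF *])
  also have "{w \<in> inv_into A f -` B \<inter> A. F w = 0} = f ` {z\<in>B. F (f z) = 0}"
  proof (intro equalityI subsetI)
    fix w assume w: "w \<in> {w \<in> inv_into A f -` B \<inter> A. F w = 0}"
    then have "f (inv_into A f w) = w"
      using bij_betw_inv_into_right[OF bij] by auto
    then show "w \<in> f ` {z\<in>B. F (f z) = 0}"
      using w by (intro image_eqI[of _ _ "inv_into A f w"]) auto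
  next
    fix w assume "w \<in> f ` {z\<in>B. F (f z) = 0}"
    then obtain z where z: "z \<in> B" "F (f z) = 0" "w = f z" by blast
    then show "w \<in> {w \<in> inv_into A f -` B \<inter> A. F w = 0}"
      using bij_betw_inv_into_left[OF bij, of z] bij_betwE[OF bij] BA by auto
  qed
  also have "emeasure (count_space UNIV) (f ` {z\<in>B. F (f z) = 0}) = emeasure (count_space UNIV) {z\<in>B. F (f z) = 0}"
  proof -
    have inj: "inj_on f {z\<in>B. F (f z) = 0}"
      using bij BA by (auto simp: bij_betw_def intro: inj_on_subset)
    show ?thesis
      using finite_image_iff[OF inj] card_image[OF inj] by (simp add: emeasure_count_space)
  qed
  also have "\<dots> = emeasure (zero_measure A (\<lambda>z. F (f z))) B"
    by (rule emeasure_zero_measure[OF B, symmetric])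
  finally show "emeasure (pullback_measure A f (zero_measure A F)) B = emeasure (zero_measure A (\<lambda>z. F (f z))) B" .
qed (simp add: pullback_measure_def sets_zero_measure)

lemma finite_set_separated:
  fixes Z :: "'a::metric_space set"
  assumes "finite Z"
  obtains e where "0 < e" "\<And>x y. x \<in> Z \<Longrightarrow> y \<in> Z \<Longrightarrow> x \<noteq> y \<Longrightarrow> e \<le> dist x y"
proof -
  \<comment> \<open>The extra element \<open>1\<close> keeps the set nonempty when \<open>Z\<close>
    has at most one point.\<close>
  let ?D = "insert 1 ((\<lambda>(x,y). dist x y) ` {(x,y). x \<in> Z \<and> y \<in> Z \<and> x \<noteq> y})"
  have fin: "finite ?D"
    by (rule finite.insertI, rule finite_imageI, rule finite_subset[of _ "Z \<times> Z"]) (use assms in auto)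
  show ?thesis
  proof (rule that[of "Min ?D"])
    show "0 < Min ?D" using fin by (subst Min_gr_iff) auto
    show "Min ?D \<le> dist x y" if "x \<in> Z" "y \<in> Z" "x \<noteq> y" for x y
      using fin that by (intro Min_le) auto
  qed
qed

text \<open>No probability enters: \<open>M\<close> will be the space of all coefficient sequences
  with its product sigma-algebra. Holomorphy is demanded for every outcome, which the default path 0
  secures where the series diverges.\<close>

locale random_analytic =
  fixes M :: "'a measure" and A :: "complex set" and F :: "'a \<Rightarrow> complex \<Rightarrow> complex"
  assumes open_A: "open A" and connected_A: "connected A"
    and holomorphic_F: "\<And>\<omega>. \<omega> \<in> space M \<Longrightarrow> F \<omega> holomorphic_on A"
    and measurable_F: "\<And>z. z \<in> A \<Longrightarrow> (\<lambda>\<omega>. F \<omega> z) \<in> borel_measurable M"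
begin

lemma continuous_F: "\<omega> \<in> space M \<Longrightarrow> continuous_on A (F \<omega>)"
  by (rule holomorphic_on_imp_continuous_on[OF holomorphic_F])

text \<open>By compactness the modulus attains its minimum over \<open>K\<close>, so a zero exists
  exactly when the values on a countable dense subset come arbitrarily close to 0; only countable
  quantifiers remain.\<close>

lemma zero_event_compact:
  assumes K: "compact K" "K \<subseteq> A"
  shows "{\<omega>\<in>space M. \<exists>z\<in>K. F \<omega> z = 0} \<in> sets M"
proof -
  obtain D where D: "countable D" "D \<subseteq> K" "K \<subseteq> closure D"
    using separable by metis
  have "{\<omega>\<in>space M. \<exists>z\<in>K. F \<omega> z = 0}
      = {\<omega>\<in>space M. \<forall>n. \<exists>z\<in>D. cmod (F \<omega> z) < 1 / real (Suc n)}"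
  proof (intro Collect_cong conj_cong refl iffI allI)
    fix \<omega> n assume \<omega>: "\<omega> \<in> space M" and "\<exists>z\<in>K. F \<omega> z = 0"
    then obtain z where z: "z \<in> K" "F \<omega> z = 0" by blast
    have "continuous_on K (F \<omega>)"
      using continuous_F[OF \<omega>] K(2) by (rule continuous_on_subset)
    then obtain d where d: "0 < d" "\<And>w. w \<in> K \<Longrightarrow> dist w z < d \<Longrightarrow> dist (F \<omega> w) (F \<omega> z) < 1 / real (Suc n)"
      using z(1) unfolding continuous_on_iff by (metis of_nat_0_less_iff zero_less_Suc zero_less_divide_1_iff)
    obtain w where "w \<in> D" "dist w z < d"
      using z(1) D(3) d(1) by (metis closure_approachable subsetD)
    then show "\<exists>z\<in>D. cmod (F \<omega> z) < 1 / real (Suc n)"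
      using d(2)[of w] D(2) z(2) by auto
  next
    fix \<omega> assume \<omega>: "\<omega> \<in> space M" and small: "\<forall>n. \<exists>z\<in>D. cmod (F \<omega> z) < 1 / real (Suc n)"
    have "continuous_on K (\<lambda>z. cmod (F \<omega> z))"
      using continuous_F[OF \<omega>] K(2) by (intro continuous_intros) (rule continuous_on_subset)
    moreover have "K \<noteq> {}" using small D(2) by auto
    ultimately obtain z where z: "z \<in> K" "\<And>w. w \<in> K \<Longrightarrow> cmod (F \<omega> z) \<le> cmod (F \<omega> w)"
      using continuous_attains_inf[OF K(1)] by metis
    have "cmod (F \<omega> z) \<le> 0"
    proof (rule ccontr)
      assume "\<not> cmod (F \<omega> z) \<le> 0"
      then obtain n where "1 / real (Suc n) < cmod (F \<omega> z)"
        using reals_Archimedean[of "cmod (F \<omega> z)"] by (auto simp: inverse_eq_divide)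
      then show False
        using small z(2) D(2) by (metis less_le_not_le order_less_trans subsetD)
    qed
    then show "\<exists>z\<in>K. F \<omega> z = 0" using z(1) by auto
  qed
  also have "\<dots> \<in> sets M"
  proof -
    have [measurable]: "(\<lambda>\<omega>. F \<omega> z) \<in> borel_measurable M" if "z \<in> D" for z
      using measurable_F that D(2) K(2) by blast
    show ?thesis
      using D(1) by measurable
  qed
  finally show ?thesis .
qed

text \<open>The number of zeros in \<open>K\<close> is the largest number of pairwise disjoint balls, taken from a
  countable family, that contain a zero in \<open>K\<close>.\<close>

lemma measurable_count_zeros_compact:
  assumes K: "compact K" "K \<subseteq> A"
  shows "(\<lambda>\<omega>. emeasure (count_space UNIV) {z\<in>K. F \<omega> z = 0}) \<in> borel_measurable M"
proof -
  obtain D :: "complex set" where D: "countable D" "UNIV \<subseteq> closure D"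
    using separable by metis
  \<comment> \<open>Closed balls keep \<open>K \<inter> C\<close> compact, as the event of a zero
    requires; countably many centres and radii leave countably many finite disjoint
    subfamilies.\<close>
  define \<U> where "\<U> = (\<lambda>(c, n). cball c (1 / real (Suc n))) ` (D \<times> (UNIV :: nat set))"
  define \<F> where "\<F> = {\<C>. finite \<C> \<and> \<C> \<subseteq> \<U> \<and> disjoint \<C>}"
  have "countable \<U>" using D(1) by (simp add: \<U>_def)
  then have "countable \<F>"
    unfolding \<F>_def
    by (intro countable_subset[OF _ countable_Collect_finite_subset[of \<U>]]) auto
  define m where "m \<C> \<omega> = (\<Sum>C\<in>\<C>. indicator {\<omega>\<in>space M. \<exists>z\<in>K \<inter> C. F \<omega> z = 0} \<omega> :: ennreal)" for \<C> \<omega>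
  have "(\<lambda>\<omega>. SUP \<C>\<in>\<F>. m \<C> \<omega>) \<in> borel_measurable M"
  proof (rule borel_measurable_SUP[OF \<open>countable \<F>\<close>])
    fix \<C> assume \<C>: "\<C> \<in> \<F>"
    have "{\<omega>\<in>space M. \<exists>z\<in>K \<inter> C. F \<omega> z = 0} \<in> sets M" if "C \<in> \<C>" for C
      using that \<C> K by (intro zero_event_compact compact_Int) (auto simp: \<F>_def \<U>_def)
    then show "m \<C> \<in> borel_measurable M"
      unfolding m_def by (intro borel_measurable_sum borel_measurable_indicator) auto
  qed
  moreover have "emeasure (count_space UNIV) {z\<in>K. F \<omega> z = 0} = (SUP \<C>\<in>\<F>. m \<C> \<omega>)"
    if \<omega>: "\<omega> \<in> space M" for \<omega>
  proof (rule antisym)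
    let ?Z = "{z\<in>K. F \<omega> z = 0}"
    show "(SUP \<C>\<in>\<F>. m \<C> \<omega>) \<le> emeasure (count_space UNIV) ?Z"
    proof (rule SUP_least)
      fix \<C> assume \<C>: "\<C> \<in> \<F>"
      have "m \<C> \<omega> \<le> (\<Sum>C\<in>\<C>. emeasure (count_space UNIV) (?Z \<inter> C))"
        unfolding m_def
      proof (rule sum_mono)
        fix C
        show "indicator {\<omega>\<in>space M. \<exists>z\<in>K \<inter> C. F \<omega> z = 0} \<omega> \<le> emeasure (count_space UNIV) (?Z \<inter> C)"
        proof (cases "\<exists>z\<in>K \<inter> C. F \<omega> z = 0")
          case True
          then obtain z where "z \<in> K" "z \<in> C" "F \<omega> z = 0" by blast
          then have "emeasure (count_space UNIV) {z} \<le> emeasure (count_space UNIV) (?Z \<inter> C)"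
            by (intro emeasure_mono) auto
          then show ?thesis by (simp add: indicator_def)
        qed (simp add: indicator_def)
      qed
      also have "\<dots> = emeasure (count_space UNIV) (\<Union>C\<in>\<C>. ?Z \<inter> C)"
        by (rule sum_emeasure) (use \<C> in \<open>auto simp: \<F>_def disjoint_family_on_def disjoint_def\<close>)
      also have "\<dots> \<le> emeasure (count_space UNIV) ?Z"
        by (rule emeasure_mono) auto
      finally show "m \<C> \<omega> \<le> emeasure (count_space UNIV) ?Z" .
    qed
    have fin: "of_nat (card Z) \<le> (SUP \<C>\<in>\<F>. m \<C> \<omega>)" if Z: "finite Z" "Z \<subseteq> ?Z" for Z
    proof -
      obtain e where e: "0 < e" "\<And>x y. x \<in> Z \<Longrightarrow> y \<in> Z \<Longrightarrow> x \<noteq> y \<Longrightarrow> e \<le> dist x y"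
        using finite_set_separated[OF Z(1)] by metis
      \<comment> \<open>Two meeting balls have centres at most 2r apart, and each centre is within r
        of its zero; the zeros would then be at most 4r apart, less than their separation
        \<open>e\<close>.\<close>
      obtain n where n: "1 / real (Suc n) < e / 4"
        using reals_Archimedean[of "e / 4"] e(1) by (auto simp: inverse_eq_divide)
      define r where "r = 1 / real (Suc n)"
      have r: "0 < r" "4 * r < e" using n by (auto simp: r_def)
      have "\<exists>c\<in>D. dist c z < r" for z
        using D(2) r(1) by (metis UNIV_I closure_approachable subsetD)
      then obtain c where c: "\<And>z. c z \<in> D" "\<And>z. dist (c z) z < r" by metis
      define B where "B z = cball (c z) r" for z
      have zB: "z \<in> B z" for z using c(2)[of z] by (simp add: B_def)
      have disj: "B x \<inter> B y = {}" if "x \<in> Z" "y \<in> Z" "x \<noteq> y" for x y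
      proof (rule ccontr)
        assume "B x \<inter> B y \<noteq> {}"
        then obtain w where "dist (c x) w \<le> r" "dist (c y) w \<le> r" by (auto simp: B_def)
        then have "dist (c x) (c y) \<le> 2 * r"
          by (smt (verit) dist_commute dist_triangle)
        then have "dist x y \<le> 4 * r"
          using c(2)[of x] c(2)[of y] by (smt (verit) dist_commute dist_triangle)
        then show False using e(2)[OF that] r(2) by linarith
      qed
      have inj: "inj_on B Z"
        using disj zB by (metis disjoint_iff inj_onI)
      have B\<F>: "B ` Z \<in> \<F>"
        using Z(1) c(1) disj by (auto simp: \<F>_def \<U>_def B_def r_def disjoint_def)
      have "m (B ` Z) \<omega> = (\<Sum>C\<in>B ` Z. 1)"
        unfolding m_def
      proof (rule sum.cong)
        fix C assume "C \<in> B ` Z"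
        then obtain z where "z \<in> Z" "C = B z" by blast
        then have "\<exists>z\<in>K \<inter> C. F \<omega> z = 0" using Z(2) zB[of z] by auto
        then show "indicator {\<omega>\<in>space M. \<exists>z\<in>K \<inter> C. F \<omega> z = 0} \<omega> = (1::ennreal)"
          using \<omega> by simp
      qed simp
      also have "\<dots> = of_nat (card Z)" by (simp add: card_image[OF inj])
      finally show ?thesis using SUP_upper[OF B\<F>, of "\<lambda>\<C>. m \<C> \<omega>"] by simp
    qed
    show "emeasure (count_space UNIV) ?Z \<le> (SUP \<C>\<in>\<F>. m \<C> \<omega>)"
    proof (cases "finite ?Z")
      case True
      then show ?thesis using fin[OF True order_refl] by (simp add: emeasure_count_space)
    next
      case False
      have "of_nat n \<le> (SUP \<C>\<in>\<F>. m \<C> \<omega>)" for n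
        using fin infinite_arbitrarily_large[OF False, of n] by metis
      then have "(SUP \<C>\<in>\<F>. m \<C> \<omega>) = \<top>"
        by (metis ennreal_SUP_of_nat_eq_top SUP_least top.extremum_unique)
      then show ?thesis by (simp only: top_greatest)
    qed
  qed
  ultimately show ?thesis by (simp cong: measurable_cong)
qed

lemma zero_function_event: "{\<omega>\<in>space M. \<forall>z\<in>A. F \<omega> z = 0} \<in> sets M"
proof -
  obtain D where D: "countable D" "D \<subseteq> A" "A \<subseteq> closure D"
    using separable by metis
  have "{\<omega>\<in>space M. \<forall>z\<in>A. F \<omega> z = 0} = {\<omega>\<in>space M. \<forall>z\<in>D. F \<omega> z = 0}"
  proof (intro Collect_cong conj_cong refl iffI)
    fix \<omega> assume \<omega>: "\<omega> \<in> space M" and 0: "\<forall>z\<in>D. F \<omega> z = 0"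
    show "\<forall>z\<in>A. F \<omega> z = 0"
    proof
      fix z assume z: "z \<in> A"
      show "F \<omega> z = 0"
      proof (rule ccontr)
        assume "F \<omega> z \<noteq> 0"
        moreover have "isCont (F \<omega>) z"
          using continuous_F[OF \<omega>] open_A z by (simp add: continuous_on_eq_continuous_at)
        ultimately obtain d where d: "0 < d" "\<And>w. dist z w < d \<Longrightarrow> F \<omega> w \<noteq> 0"
          using continuous_at_avoid by metis
        obtain w where "w \<in> D" "dist w z < d"
          using z D(3) d(1) by (metis closure_approachable subsetD)
        then show False using d(2) 0 by (auto simp: dist_commute)
      qed
    qed
  qed (use D in auto)
  also have "\<dots> \<in> sets M"
  proof -
    have [measurable]: "(\<lambda>\<omega>. F \<omega> z) \<in> borel_measurable M" if "z \<in> D" for z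
      using measurable_F that D(2) by blast
    show ?thesis using D(1) by measurable
  qed
  finally show ?thesis .
qed

text \<open>Connectedness of \<open>A\<close> enters through the identity theorem: the zeros of a
  nonconstant function cannot accumulate inside \<open>A\<close>. A constant other than 0 has no
  zeros at all.\<close>

lemma finite_zeros_compact:
  assumes \<omega>: "\<omega> \<in> space M" and nz: "\<not> (\<forall>z\<in>A. F \<omega> z = 0)" and K: "compact K" "K \<subseteq> A"
  shows "finite {z\<in>K. F \<omega> z = 0}"
proof (cases "F \<omega> constant_on A")
  case True
  then have "{z\<in>K. F \<omega> z = 0} = {}" using nz K by (auto simp: constant_on_def)
  then show ?thesis by (simp only: finite.emptyI)
next
  case False
  then show ?thesis
    by (rule holomorphic_compact_finite_zeros[OF holomorphic_F[OF \<omega>] open_A connected_A K])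
qed

text \<open>Off the event that the function vanishes identically, the zeros in a compact set form a finite
  measure, so Dynkin's theorem passes from closed to Borel sets.\<close>

lemma measurable_count_zeros_borel:
  assumes K: "compact K" "K \<subseteq> A" and B: "B \<in> sets borel"
  shows "(\<lambda>\<omega>. if \<forall>z\<in>A. F \<omega> z = 0 then 0
              else emeasure (count_space UNIV) {z\<in>B \<inter> K. F \<omega> z = 0}) \<in> borel_measurable M"
proof -
  let ?n = "\<lambda>B \<omega>. if \<forall>z\<in>A. F \<omega> z = 0 then 0
              else emeasure (count_space UNIV) {z\<in>B \<inter> K. F \<omega> z = 0}"
  have closed: "?n B \<in> borel_measurable M" if "closed B" for B
    using zero_function_event measurable_count_zeros_compact[of "B \<inter> K"] K that
    by (intro measurable_If) (auto intro: closed_Int_compact)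
  have "Int_stable (Collect closed :: complex set set)" by (auto simp: Int_stable_def)
  moreover have "Collect closed \<subseteq> Pow (UNIV :: complex set)" by simp
  moreover have "B \<in> sigma_sets UNIV (Collect closed)"
    using B by (simp add: borel_eq_closed)
  ultimately show ?thesis
  proof (induction rule: sigma_sets_induct_disjoint)
    case (basic B)
    then show ?case using closed by simp
  next
    case empty
    show ?case by (rule closed) simp
  next
    case (compl B)
    \<comment> \<open>Off the zero path the count in the compact \<open>K\<close> is finite, so it
      may be subtracted. On the zero path, where counts could be infinite, the artificial value
      \<open>0\<close> turns the identity into 0 = 0 - 0.\<close>
    have "?n (UNIV - B) \<omega> = ?n UNIV \<omega> - ?n B \<omega>" if \<omega>: "\<omega> \<in> space M" for \<omega>
    proof (cases "\<forall>z\<in>A. F \<omega> z = 0")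
      case False
      let ?Z = "\<lambda>B. {z\<in>B \<inter> K. F \<omega> z = 0}"
      have eq: "?Z (UNIV - B) = ?Z UNIV - ?Z B"
        by auto
      have "finite (?Z B)"
        using finite_zeros_compact[OF \<omega> False K] by (rule rev_finite_subset) auto
      then have "emeasure (count_space UNIV) (?Z UNIV - ?Z B)
          = emeasure (count_space UNIV) (?Z UNIV) - emeasure (count_space UNIV) (?Z B)"
        by (intro emeasure_Diff) auto
      then show ?thesis
        unfolding if_not_P[OF False] eq .
    qed simp
    moreover have "?n UNIV \<in> borel_measurable M" by (rule closed) simp
    ultimately show ?case
      using borel_measurable_minus_ennreal[OF _ compl.IH]
      by (subst measurable_cong[where g = "\<lambda>\<omega>. ?n UNIV \<omega> - ?n B \<omega>"])
  next
    case (union B)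
    have "?n (\<Union>i. B i) \<omega> = (\<Sum>i. ?n (B i) \<omega>)" for \<omega>
    proof (cases "\<forall>z\<in>A. F \<omega> z = 0")
      case False
      let ?Z = "\<lambda>B. {z\<in>B \<inter> K. F \<omega> z = 0}"
      have eq: "?Z (\<Union>i. B i) = (\<Union>i. ?Z (B i))"
        by auto
      have "disjoint_family (\<lambda>i. ?Z (B i))"
        using union.hyps by (auto simp: disjoint_family_on_def)
      then show ?thesis
        unfolding if_not_P[OF False] eq by (intro suminf_emeasure[symmetric]) auto
    qed simp
    then show ?case
      using union.IH borel_measurable_suminf_order[of "\<lambda>i. ?n (B i)" M] by (simp only:)
  qed
qed

text \<open>On the zero path the count of \<open>B\<close> is its cardinality, which does not depend
  on the outcome and may harmlessly be infinite. On all other paths the counts over a compact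
  exhaustion of \<open>A\<close> increase to the full count.\<close>

lemma measurable_zero_measure:
  "(\<lambda>\<omega>. zero_measure A (F \<omega>)) \<in> M \<rightarrow>\<^sub>M measure_algebra (restrict_space borel A)"
proof (rule measurable_measure_algebra)
  fix B assume B: "B \<in> sets (restrict_space borel A)"
  then have BA: "B \<subseteq> A" and Bb: "B \<in> sets borel"
    using open_A by (auto simp: sets_restrict_space)
  obtain K where K: "\<And>n::nat. compact (K n)" "\<And>n. K n \<subseteq> A" "\<And>n. K n \<subseteq> K (Suc n)" "(\<Union>n. K n) = A"
    using open_Union_compact_subsets[OF open_A] by (metis (no_types, lifting) order.trans interior_subset)
  let ?n = "\<lambda>n \<omega>. if \<forall>z\<in>A. F \<omega> z = 0 then 0
              else emeasure (count_space UNIV) {z\<in>B \<inter> K n. F \<omega> z = 0}"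
  have "emeasure (zero_measure A (F \<omega>)) B
      = (if \<forall>z\<in>A. F \<omega> z = 0 then emeasure (count_space UNIV) B else (SUP n. ?n n \<omega>))" for \<omega>
  proof (cases "\<forall>z\<in>A. F \<omega> z = 0")
    case True
    then have "{z\<in>B. F \<omega> z = 0} = B" using BA by auto
    then show ?thesis using True by (simp add: emeasure_zero_measure[OF B])
  next
    case False
    have "incseq K" using K(3) by (rule incseq_SucI)
    then have "incseq (\<lambda>n. {z\<in>B \<inter> K n. F \<omega> z = 0})" by (fastforce simp: incseq_def)
    then have "(SUP n. emeasure (count_space UNIV) {z\<in>B \<inter> K n. F \<omega> z = 0})
        = emeasure (count_space UNIV) (\<Union>n. {z\<in>B \<inter> K n. F \<omega> z = 0})"
      by (intro SUP_emeasure_incseq) auto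
    also have "(\<Union>n. {z\<in>B \<inter> K n. F \<omega> z = 0}) = {z\<in>B. F \<omega> z = 0}"
      using BA K(4) by auto
    finally show ?thesis unfolding if_not_P[OF False] by (simp add: emeasure_zero_measure[OF B])
  qed
  moreover have "(\<lambda>\<omega>. SUP n. ?n n \<omega>) \<in> borel_measurable M"
    using measurable_count_zeros_borel[OF K(1,2) Bb] by (intro borel_measurable_SUP) auto
  then have "(\<lambda>\<omega>. if \<forall>z\<in>A. F \<omega> z = 0 then emeasure (count_space UNIV) B else (SUP n. ?n n \<omega>))
      \<in> borel_measurable M"
    by (intro measurable_If[OF _ _ zero_function_event]) simp_all
  ultimately show "(\<lambda>\<omega>. emeasure (zero_measure A (F \<omega>)) B) \<in> borel_measurable M" by simp
qed (rule sets_zero_measure)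

end

section \<open>Conformal automorphisms of an annulus\<close>

lemma open_annulus: "open (annulus q)"
  unfolding annulus_def by (intro open_Collect_conj open_Collect_less continuous_intros)

lemma connected_annulus_complex: "connected (annulus q)"
  using connected_annulus[of q "0::complex" 1] by (simp add: annulus_def)

lemma annulus_nonempty:
  assumes "0 < q" "q < 1"
  shows "annulus q \<noteq> {}"
proof -
  have "complex_of_real ((q + 1) / 2) \<in> annulus q"
    using assms by (simp add: annulus_def norm_divide flip: of_real_add)
  then show ?thesis by blast
qed

lemma annulus_nonzero: "0 < q \<Longrightarrow> z \<in> annulus q \<Longrightarrow> z \<noteq> 0"
  by (auto simp: annulus_def)

lemma inversion_annulus:
  assumes "0 < q" "z \<in> annulus q"
  shows "inversion q z \<in> annulus q"
  using assms annulus_nonzero[OF assms]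
  by (auto simp: inversion_def annulus_def norm_divide field_simps)

lemma inversion_inversion:
  "0 < q \<Longrightarrow> z \<in> annulus q \<Longrightarrow> inversion q (inversion q z) = z"
  using annulus_nonzero[of q z] by (simp add: inversion_def)

lemma conformal_automorphism_inversion:
  assumes "0 < q"
  shows "conformal_automorphism (annulus q) (inversion q)"
  unfolding conformal_automorphism_def
proof
  show "inversion q holomorphic_on annulus q"
    unfolding inversion_def using annulus_nonzero[OF assms] by (auto intro!: holomorphic_intros)
  show "bij_betw (inversion q) (annulus q) (annulus q)"
    by (rule bij_betwI[where g = "inversion q"])
       (use assms inversion_annulus inversion_inversion in auto)
qed

lemma conformal_automorphism_compose:
  assumes "conformal_automorphism A f" "conformal_automorphism A g"
  shows "conformal_automorphism A (f \<circ> g)"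
  using assms unfolding conformal_automorphism_def
  by (metis bij_betw_imp_surj_on bij_betw_trans holomorphic_on_compose)

section \<open>Boundary behaviour of automorphisms\<close>

text \<open>A property holding eventually as the modulus tends to 1, and in
  \<open>near_inner\<close> to \<open>q\<close>, uniformly in the argument. The extreme radii,
  \<open>q\<close> here and 1 there, stand for the whole annulus.\<close>

definition near_outer :: "real \<Rightarrow> (complex \<Rightarrow> bool) \<Rightarrow> bool" where
  "near_outer q P \<longleftrightarrow> (\<exists>\<rho>. q \<le> \<rho> \<and> \<rho> < 1 \<and> (\<forall>z\<in>annulus q. \<rho> < cmod z \<longrightarrow> P z))"

definition near_inner :: "real \<Rightarrow> (complex \<Rightarrow> bool) \<Rightarrow> bool" where
  "near_inner q P \<longleftrightarrow> (\<exists>\<rho>. q < \<rho> \<and> \<rho> \<le> 1 \<and> (\<forall>z\<in>annulus q. cmod z < \<rho> \<longrightarrow> P z))"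

lemma near_outer_mono:
  "near_outer q P \<Longrightarrow> (\<And>z. z \<in> annulus q \<Longrightarrow> P z \<Longrightarrow> Q z) \<Longrightarrow> near_outer q Q"
  unfolding near_outer_def by blast

lemma near_inner_mono:
  "near_inner q P \<Longrightarrow> (\<And>z. z \<in> annulus q \<Longrightarrow> P z \<Longrightarrow> Q z) \<Longrightarrow> near_inner q Q"
  unfolding near_inner_def by blast

lemma near_outer_radius: "q < 1 \<Longrightarrow> r < 1 \<Longrightarrow> near_outer q (\<lambda>z. r < cmod z)"
  unfolding near_outer_def by (intro exI[of _ "max q r"]) auto

lemma near_inner_radius: "q < 1 \<Longrightarrow> q < r \<Longrightarrow> near_inner q (\<lambda>z. cmod z < r)"
  unfolding near_inner_def by (intro exI[of _ "min 1 r"]) auto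

text \<open>The inversion exchanges the two ends: |q/z| < \<rho> means |z| > q/\<rho>, and
  \<open>q / \<rho>\<close> again lies in [q, 1).\<close>

lemma near_inner_inversion:
  assumes q: "0 < q" and P: "near_inner q P"
  shows "near_outer q (\<lambda>z. P (inversion q z))"
proof -
  obtain \<rho> where \<rho>: "q < \<rho>" "\<rho> \<le> 1" "\<And>z. z \<in> annulus q \<Longrightarrow> cmod z < \<rho> \<Longrightarrow> P z"
    using P unfolding near_inner_def by blast
  have "cmod (inversion q z) < \<rho>" if "z \<in> annulus q" "q / \<rho> < cmod z" for z
    using that \<rho> q annulus_nonzero[OF q that(1)]
    by (simp add: inversion_def norm_divide field_simps)
  then show ?thesis
    unfolding near_outer_def using \<rho> q inversion_annulus[OF q]
    by (intro exI[of _ "q / \<rho>"]) (auto simp: field_simps)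
qed

lemma near_outer_inversion:
  assumes q: "0 < q" and P: "near_outer q P"
  shows "near_inner q (\<lambda>z. P (inversion q z))"
proof -
  obtain \<rho> where \<rho>: "q \<le> \<rho>" "\<rho> < 1" "\<And>z. z \<in> annulus q \<Longrightarrow> \<rho> < cmod z \<Longrightarrow> P z"
    using P unfolding near_outer_def by blast
  have "\<rho> < cmod (inversion q z)" if "z \<in> annulus q" "cmod z < q / \<rho>" for z
    using that \<rho> q annulus_nonzero[OF q that(1)]
    by (simp add: inversion_def norm_divide field_simps)
  then show ?thesis
    unfolding near_inner_def using \<rho> q inversion_annulus[OF q]
    by (intro exI[of _ "q / \<rho>"]) (auto simp: field_simps)
qed

lemma compact_closed_annulus: "compact {z::complex. a \<le> cmod z \<and> cmod z \<le> b}"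
proof -
  have "closed {z::complex. a \<le> cmod z \<and> cmod z \<le> b}"
    by (intro closed_Collect_conj closed_Collect_le continuous_intros)
  moreover have "bounded {z::complex. a \<le> cmod z \<and> cmod z \<le> b}"
    by (rule boundedI[of _ b]) auto
  ultimately show ?thesis by (simp add: compact_eq_bounded_closed)
qed

lemma compact_subset_annulus:
  assumes q: "0 < q" "q < 1" and K: "compact K" "K \<subseteq> annulus q"
  obtains a b where "q < a" "a \<le> b" "b < 1" "K \<subseteq> {z. a \<le> cmod z \<and> cmod z \<le> b}"
proof (cases "K = {}")
  case True
  \<comment> \<open>The empty case does arise, from rings whose inner radius exceeds the outer
    one.\<close>
  then show ?thesis using that[of "(q+1)/2" "(q+1)/2"] q by auto
next
  case False
  have c: "continuous_on K cmod" by (intro continuous_intros)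
  obtain x where x: "x \<in> K" "\<And>z. z \<in> K \<Longrightarrow> cmod z \<le> cmod x"
    using continuous_attains_sup[OF K(1) False c] by auto
  obtain y where y: "y \<in> K" "\<And>z. z \<in> K \<Longrightarrow> cmod y \<le> cmod z"
    using continuous_attains_inf[OF K(1) False c] by auto
  have "q < cmod y" "cmod x < 1" using x y K(2) by (auto simp: annulus_def)
  then show ?thesis
    using that[of "cmod y" "cmod x"] x y by auto
qed

text \<open>This is properness of \<open>f\<close>: its inverse is continuous, so the preimage of
  the closed ring of radii \<open>a\<close> to \<open>b\<close> is compact and stays away from the
  outer circle.\<close>

lemma conformal_automorphism_outer_avoids:
  assumes q: "0 < q" "q < 1" and f: "conformal_automorphism (annulus q) f"
    and ab: "q < a" "b < 1"
  obtains \<rho> where "q \<le> \<rho>" "\<rho> < 1"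
    "\<And>z. z \<in> annulus q \<Longrightarrow> \<rho> < cmod z \<Longrightarrow> cmod (f z) < a \<or> b < cmod (f z)"
proof -
  let ?A = "annulus q"
  have hol: "f holomorphic_on ?A" and bij: "bij_betw f ?A ?A"
    using f by (auto simp: conformal_automorphism_def)
  obtain g where g: "g holomorphic_on (f ` ?A)" "\<And>z. z \<in> ?A \<Longrightarrow> g (f z) = z"
    using holomorphic_has_inverse[OF hol open_annulus bij_betw_imp_inj_on[OF bij]] by metis
  have im: "f ` ?A = ?A" using bij by (rule bij_betw_imp_surj_on)
  define K where "K = {w::complex. a \<le> cmod w \<and> cmod w \<le> b}"
  have KA: "K \<subseteq> ?A" using ab by (auto simp: K_def annulus_def)
  have "continuous_on K g"
    using holomorphic_on_imp_continuous_on[OF g(1)] KA im by (auto intro: continuous_on_subset)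
  then have "compact (g ` K)"
    using compact_closed_annulus unfolding K_def by (rule compact_continuous_image)
  moreover have "g ` K \<subseteq> ?A"
  proof
    fix w assume "w \<in> g ` K"
    then obtain k where k: "k \<in> K" "w = g k" by blast
    then have "k \<in> f ` ?A" using KA by (auto simp: im)
    then obtain z where "z \<in> ?A" "w = g (f z)" using k by blast
    then show "w \<in> ?A" using g(2) by simp
  qed
  ultimately obtain a' b' where *: "q < a'" "a' \<le> b'" "b' < 1" "g ` K \<subseteq> {z. a' \<le> cmod z \<and> cmod z \<le> b'}"
    by (rule compact_subset_annulus[OF q])
  show ?thesis
  proof (rule that)
    show "q \<le> b'" "b' < 1" using * by auto
    fix z assume z: "z \<in> ?A" "b' < cmod z"
    have "f z \<notin> K"
      using g(2)[OF z(1)] *(4) z(2) by fastforce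
    then show "cmod (f z) < a \<or> b < cmod (f z)" by (auto simp: K_def)
  qed
qed

text \<open>Near the outer circle \<open>|f|\<close> avoids each given compact range of radii, and a thin outer ring is
  connected, so \<open>|f|\<close> tends to a single one of the two boundary radii.\<close>

lemma conformal_automorphism_outer_limit:
  assumes q: "0 < q" "q < 1" and f: "conformal_automorphism (annulus q) f"
  shows "(\<forall>e>0. near_outer q (\<lambda>z. 1 - e < cmod (f z))) \<or> (\<forall>e>0. near_outer q (\<lambda>z. cmod (f z) < q + e))"
proof -
  let ?A = "annulus q"
  define s where "s = (q + 1) / 2"
  have s: "q < s" "s < 1" using q by (auto simp: s_def)
  have fA: "f z \<in> ?A" if "z \<in> ?A" for z
    using f that by (auto simp: conformal_automorphism_def bij_betw_def)
  have cont: "continuous_on ?A f"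
    using f by (auto simp: conformal_automorphism_def holomorphic_on_imp_continuous_on)
  obtain \<rho>0 where \<rho>0: "q \<le> \<rho>0" "\<rho>0 < 1"
    "\<And>z. z \<in> ?A \<Longrightarrow> \<rho>0 < cmod z \<Longrightarrow> cmod (f z) < s \<or> s < cmod (f z)"
    using conformal_automorphism_outer_avoids[OF q f s] by metis
  define R where "R = annulus \<rho>0"
  have RA: "R \<subseteq> ?A" using \<rho>0 by (auto simp: R_def annulus_def)
  have "connected ((\<lambda>z. cmod (f z)) ` R)"
    unfolding R_def using cont RA[unfolded R_def]
    by (intro connected_continuous_image connected_annulus_complex continuous_intros) (rule continuous_on_subset)
  moreover have "s \<notin> (\<lambda>z. cmod (f z)) ` R"
    using \<rho>0(3) RA by (force simp: R_def annulus_def)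
  ultimately have dich: "(\<forall>z\<in>R. s < cmod (f z)) \<or> (\<forall>z\<in>R. cmod (f z) < s)"
    by (smt (verit, best) connectedD_interval imageI)
  have Rm: "z \<in> R" if "z \<in> ?A" "\<rho>0 < cmod z" for z
    using that by (auto simp: R_def annulus_def)
  from dich show ?thesis
  proof
    assume R: "\<forall>z\<in>R. s < cmod (f z)"
    \<comment> \<open>The forbidden range of radii is now \<open>s\<close> to \<open>1 - e\<close>;
      on \<open>R\<close> the alternative below \<open>s\<close> is already excluded.\<close>
    have "near_outer q (\<lambda>z. 1 - e < cmod (f z))" if "0 < e" for e
    proof -
      from that have "1 - e < 1" by simp
      obtain \<rho> where \<rho>: "q \<le> \<rho>" "\<rho> < 1"
        "\<And>z. z \<in> ?A \<Longrightarrow> \<rho> < cmod z \<Longrightarrow> cmod (f z) < s \<or> 1 - e < cmod (f z)"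
        using conformal_automorphism_outer_avoids[OF q f s(1) \<open>1 - e < 1\<close>] by metis
      show "near_outer q (\<lambda>z. 1 - e < cmod (f z))"
        unfolding near_outer_def using \<rho> \<rho>0 R Rm by (intro exI[of _ "max \<rho> \<rho>0"]) force
    qed
    then show ?thesis by blast
  next
    assume R: "\<forall>z\<in>R. cmod (f z) < s"
    have "near_outer q (\<lambda>z. cmod (f z) < q + e)" if "0 < e" for e
    proof -
      from that have "q < q + e" by simp
      obtain \<rho> where \<rho>: "q \<le> \<rho>" "\<rho> < 1"
        "\<And>z. z \<in> ?A \<Longrightarrow> \<rho> < cmod z \<Longrightarrow> cmod (f z) < q + e \<or> s < cmod (f z)"
        using conformal_automorphism_outer_avoids[OF q f \<open>q < q + e\<close> s(2)] by metis
      show "near_outer q (\<lambda>z. cmod (f z) < q + e)"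
        unfolding near_outer_def using \<rho> \<rho>0 R Rm by (intro exI[of _ "max \<rho> \<rho>0"]) force
    qed
    then show ?thesis by blast
  qed
qed

text \<open>Precomposition with the inversion turns the inner end of \<open>f\<close> into the outer
  end of another automorphism.\<close>

lemma conformal_automorphism_inner_limit:
  assumes q: "0 < q" "q < 1" and f: "conformal_automorphism (annulus q) f"
  shows "(\<forall>e>0. near_inner q (\<lambda>z. 1 - e < cmod (f z))) \<or> (\<forall>e>0. near_inner q (\<lambda>z. cmod (f z) < q + e))"
proof -
  have g: "conformal_automorphism (annulus q) (f \<circ> inversion q)"
    by (rule conformal_automorphism_compose[OF f conformal_automorphism_inversion[OF q(1)]])
  have transfer: "near_inner q (\<lambda>z. P (f z))" if "near_outer q (\<lambda>z. P ((f \<circ> inversion q) z))" for P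
    using near_outer_inversion[OF q(1) that]
    by (rule near_inner_mono) (use inversion_inversion[OF q(1)] in auto)
  show ?thesis
    using conformal_automorphism_outer_limit[OF q g]
      transfer[where P = "\<lambda>w. _ < cmod w"] transfer[where P = "\<lambda>w. cmod w < _"] by meson
qed

text \<open>Without boundary values of \<open>h\<close>, the maximum principle is applied on a
  slightly smaller closed ring, whose two bounding circles lie where |h| is already below
  \<open>C + e\<close>; then \<open>e\<close> tends to 0.\<close>

lemma maximum_modulus_annulus:
  assumes q: "0 < q" "q < 1" and h: "h holomorphic_on annulus q"
    and out: "\<And>e. 0 < e \<Longrightarrow> near_outer q (\<lambda>z. cmod (h z) < C + e)"
    and inn: "\<And>e. 0 < e \<Longrightarrow> near_inner q (\<lambda>z. cmod (h z) < C + e)"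
    and z: "z \<in> annulus q"
  shows "cmod (h z) \<le> C"
proof (rule field_le_epsilon)
  fix e :: real assume "0 < e"
  obtain \<rho>1 where \<rho>1: "q \<le> \<rho>1" "\<rho>1 < 1" "\<And>z. z \<in> annulus q \<Longrightarrow> \<rho>1 < cmod z \<Longrightarrow> cmod (h z) < C + e"
    using out[OF \<open>0 < e\<close>] unfolding near_outer_def by blast
  obtain \<rho>2 where \<rho>2: "q < \<rho>2" "\<rho>2 \<le> 1" "\<And>z. z \<in> annulus q \<Longrightarrow> cmod z < \<rho>2 \<Longrightarrow> cmod (h z) < C + e"
    using inn[OF \<open>0 < e\<close>] unfolding near_inner_def by blast
  have zz: "q < cmod z" "cmod z < 1" using z by (auto simp: annulus_def)
  obtain a where a: "q < a" "a < min \<rho>2 (cmod z)"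
    using dense[of q "min \<rho>2 (cmod z)"] \<rho>2 zz by auto
  obtain b where b: "max \<rho>1 (cmod z) < b" "b < 1"
    using dense[of "max \<rho>1 (cmod z)" 1] \<rho>1 zz by auto
  define S where "S = {w::complex. a \<le> cmod w \<and> cmod w \<le> b}"
  have cS: "compact S" unfolding S_def by (rule compact_closed_annulus)
  have SA: "S \<subseteq> annulus q" using a b by (auto simp: S_def annulus_def)
  have "open {w::complex. a < cmod w \<and> cmod w < b}"
    by (intro open_Collect_conj open_Collect_less continuous_intros)
  then have "{w. a < cmod w \<and> cmod w < b} \<subseteq> interior S"
    by (intro interior_maximal) (auto simp: S_def)
  then have fr: "cmod w = a \<or> cmod w = b" if "w \<in> frontier S" for w
    using that closure_closed[OF compact_imp_closed[OF cS]]
    by (force simp: frontier_def S_def)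
  show "cmod (h z) \<le> C + e"
  proof (rule maximum_modulus_frontier[of h S])
    show "h holomorphic_on interior S"
      using h SA interior_subset by (metis holomorphic_on_subset subset_trans)
    show "continuous_on (closure S) h"
      using h SA closure_closed[OF compact_imp_closed[OF cS]]
      by (metis continuous_on_subset holomorphic_on_imp_continuous_on)
    show "bounded S" using cS by (rule compact_imp_bounded)
    show "z \<in> S" using a b by (auto simp: S_def)
    fix w assume w: "w \<in> frontier S"
    then have "w \<in> annulus q"
      using SA closure_closed[OF compact_imp_closed[OF cS]] by (auto simp: frontier_def)
    then show "cmod (h w) \<le> C + e"
      using fr[OF w] \<rho>1(3)[of w] \<rho>2(3)[of w] a b by force
  qed
qed

text \<open>Both f(z)/z and z/f(z) are holomorphic with moduli at most 1 in the limit at either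
  circle. The maximum principle for each gives modulus exactly 1, and a holomorphic function of
  constant modulus is constant.\<close>

lemma conformal_automorphism_annulus_rotation:
  assumes q: "0 < q" "q < 1" and f: "conformal_automorphism (annulus q) f"
    and out: "\<And>e. 0 < e \<Longrightarrow> near_outer q (\<lambda>z. 1 - e < cmod (f z))"
    and inn: "\<And>e. 0 < e \<Longrightarrow> near_inner q (\<lambda>z. cmod (f z) < q + e)"
  obtains c where "cmod c = 1" "\<And>z. z \<in> annulus q \<Longrightarrow> f z = c * z"
proof -
  let ?A = "annulus q"
  have hol: "f holomorphic_on ?A"
    using f by (simp add: conformal_automorphism_def)
  have fA: "f z \<in> ?A" if "z \<in> ?A" for z
    using f that by (auto simp: conformal_automorphism_def bij_betw_def)
  have nz: "z \<noteq> 0" "f z \<noteq> 0" if "z \<in> ?A" for z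
    using annulus_nonzero[OF q(1)] fA that by auto
  have "cmod (f z / z) \<le> 1" if "z \<in> ?A" for z
  proof (rule maximum_modulus_annulus[OF q _ _ _ that, of "\<lambda>z. f z / z"])
    show "(\<lambda>z. f z / z) holomorphic_on ?A"
      using nz hol by (auto intro!: holomorphic_intros)
    fix e :: real assume e: "0 < e"
    \<comment> \<open>At the outer circle |f| < 1 and a lower bound on |z| suffice; at the inner
      one, |z| > q and the assumed limit in the form |f| < q + q e.\<close>
    have "cmod (f z / z) < 1 + e" if "z \<in> ?A" "1 / (1 + e) < cmod z" for z
    proof -
      have "cmod (f z) < 1" using fA[OF that(1)] by (simp add: annulus_def)
      also have "1 < (1 + e) * cmod z" using that e by (simp add: field_simps)
      finally show ?thesis using nz[OF that(1)] by (simp add: norm_divide divide_simps mult.commute)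
    qed
    then show "near_outer q (\<lambda>z. cmod (f z / z) < 1 + e)"
      using near_outer_mono[OF near_outer_radius[of q "1 / (1 + e)"]] q e by simp
    have "cmod (f z / z) < 1 + e" if "z \<in> ?A" "cmod (f z) < q + q * e" for z
    proof -
      have "cmod (f z) < q * (1 + e)" using that by (simp add: distrib_left)
      also have "\<dots> < cmod z * (1 + e)" using that e by (auto simp: annulus_def)
      finally show ?thesis using nz[OF that(1)] by (simp add: norm_divide divide_simps mult.commute)
    qed
    then show "near_inner q (\<lambda>z. cmod (f z / z) < 1 + e)"
      using near_inner_mono[OF inn[of "q * e"]] q e by simp
  qed
  moreover have "cmod (z / f z) \<le> 1" if "z \<in> ?A" for z
  proof (rule maximum_modulus_annulus[OF q _ _ _ that, of "\<lambda>z. z / f z"])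
    show "(\<lambda>z. z / f z) holomorphic_on ?A"
      using nz hol by (auto intro!: holomorphic_intros)
    fix e :: real assume e: "0 < e"
    \<comment> \<open>The threshold equals 1/(1 + e).\<close>
    have "cmod (z / f z) < 1 + e" if "z \<in> ?A" "1 - e / (1 + e) < cmod (f z)" for z
    proof -
      have "1 < (1 + e) * cmod (f z)" using that e by (simp add: field_simps)
      moreover have "cmod z < 1" using that by (simp add: annulus_def)
      ultimately show ?thesis using nz[OF that(1)] by (simp add: norm_divide divide_simps mult.commute)
    qed
    then show "near_outer q (\<lambda>z. cmod (z / f z) < 1 + e)"
      using near_outer_mono[OF out[of "e / (1 + e)"]] e by simp
    have "cmod (z / f z) < 1 + e" if "z \<in> ?A" "cmod z < q * (1 + e)" for z
    proof -
      have "q * (1 + e) < cmod (f z) * (1 + e)"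
        using fA[OF that(1)] e by (auto simp: annulus_def)
      with that(2) show ?thesis using nz[OF that(1)] by (simp add: norm_divide divide_simps mult.commute)
    qed
    then show "near_inner q (\<lambda>z. cmod (z / f z) < 1 + e)"
      using near_inner_mono[OF near_inner_radius[of q "q * (1 + e)"]] q e by simp
  qed
  ultimately have one: "cmod (f z / z) = 1" if "z \<in> ?A" for z
    using that nz[OF that] by (force simp: norm_divide divide_simps split: if_splits)
  obtain z0 where z0: "z0 \<in> ?A" using annulus_nonempty[OF q] by blast
  have "(\<lambda>z. f z / z) constant_on ?A"
  proof (rule maximum_modulus_principle[OF _ open_annulus connected_annulus_complex open_annulus subset_refl z0])
    show "(\<lambda>z. f z / z) holomorphic_on ?A"
      using nz hol by (auto intro!: holomorphic_intros)
  qed (use one z0 in auto)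
  then obtain c where c: "\<And>z. z \<in> ?A \<Longrightarrow> f z / z = c"
    by (auto simp: constant_on_def)
  show ?thesis
  proof (rule that)
    show "cmod c = 1" using one[OF z0] c[OF z0] by simp
    show "f z = c * z" if "z \<in> ?A" for z using c[OF that] nz[OF that] by (simp add: field_simps)
  qed
qed

text \<open>If both boundary circles were sent to the same one, the maximum principle for \<open>f\<close> or
  \<open>1 / f\<close> would force \<open>|f|\<close> to leave \<open>(q, 1)\<close>; otherwise \<open>f z / z\<close> or \<open>f (q / z) / z\<close> has modulus \<open>1\<close>
  on the boundary.\<close>

lemma conformal_automorphism_annulus:
  assumes q: "0 < q" "q < 1" and f: "conformal_automorphism (annulus q) f"
  obtains
    (rotation) c where "cmod c = 1" "\<And>z. z \<in> annulus q \<Longrightarrow> f z = c * z"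
  | (reflection) c where "cmod c = 1" "\<And>z. z \<in> annulus q \<Longrightarrow> f z = c * inversion q z"
proof -
  let ?A = "annulus q"
  have hol: "f holomorphic_on ?A"
    using f by (simp add: conformal_automorphism_def)
  have fA: "f z \<in> ?A" if "z \<in> ?A" for z
    using f that by (auto simp: conformal_automorphism_def bij_betw_def)
  have nz: "z \<noteq> 0" "f z \<noteq> 0" if "z \<in> ?A" for z
    using annulus_nonzero[OF q(1)] fA that by auto
  obtain z0 where z0: "z0 \<in> ?A" using annulus_nonempty[OF q] by blast
  show ?thesis
    using conformal_automorphism_outer_limit[OF q f]
  proof
    assume out: "\<forall>e>0. near_outer q (\<lambda>z. 1 - e < cmod (f z))"
    show ?thesis
      using conformal_automorphism_inner_limit[OF q f]
    proof
      assume inn: "\<forall>e>0. near_inner q (\<lambda>z. 1 - e < cmod (f z))"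
      have inv: "cmod (1 / f z) < 1 + e" if "0 < e" "z \<in> ?A" "1 - e / (1 + e) < cmod (f z)" for z e
      proof -
        have "1 < (1 + e) * cmod (f z)" using that by (simp add: field_simps)
        then show ?thesis using nz[OF that(2)] by (simp add: norm_divide divide_simps mult.commute)
      qed
      have "cmod (1 / f z0) \<le> 1"
      proof (rule maximum_modulus_annulus[OF q _ _ _ z0, of "\<lambda>z. 1 / f z"])
        show "(\<lambda>z. 1 / f z) holomorphic_on ?A"
          using nz hol by (auto intro!: holomorphic_intros)
        fix e :: real assume e: "0 < e"
        then have "0 < e / (1 + e)" by simp
        from out[rule_format, OF this] inn[rule_format, OF this]
        show "near_outer q (\<lambda>z. cmod (1 / f z) < 1 + e)"
          "near_inner q (\<lambda>z. cmod (1 / f z) < 1 + e)"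
          by - (erule near_outer_mono near_inner_mono, erule (1) inv[OF e])+
      qed
      moreover have "cmod (f z0) < 1" using fA[OF z0] by (simp add: annulus_def)
      ultimately show ?thesis using nz[OF z0] by (simp add: norm_divide divide_simps)
    next
      assume inn: "\<forall>e>0. near_inner q (\<lambda>z. cmod (f z) < q + e)"
      show ?thesis
        using conformal_automorphism_annulus_rotation[OF q f out[rule_format] inn[rule_format]] rotation by metis
    qed
  next
    assume out: "\<forall>e>0. near_outer q (\<lambda>z. cmod (f z) < q + e)"
    show ?thesis
      using conformal_automorphism_inner_limit[OF q f]
    proof
      assume inn: "\<forall>e>0. near_inner q (\<lambda>z. 1 - e < cmod (f z))"
      \<comment> \<open>The two ends are swapped by \<open>f\<close> and swapped back by the
        inversion, so \<open>?g\<close> falls under the rotation case.\<close>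
      let ?g = "f \<circ> inversion q"
      have g: "conformal_automorphism ?A ?g"
        by (rule conformal_automorphism_compose[OF f conformal_automorphism_inversion[OF q(1)]])
      have gi: "?g (inversion q z) = f z" if "z \<in> ?A" for z
        using inversion_inversion[OF q(1) that] by simp
      have outg: "near_outer q (\<lambda>z. 1 - e < cmod (?g z))" if "0 < e" for e
        using near_inner_inversion[OF q(1) inn[rule_format, OF that]] by simp
      have inng: "near_inner q (\<lambda>z. cmod (?g z) < q + e)" if "0 < e" for e
        using near_outer_inversion[OF q(1) out[rule_format, OF that]] by simp
      obtain c where "cmod c = 1" "\<And>z. z \<in> ?A \<Longrightarrow> ?g z = c * z"
        using conformal_automorphism_annulus_rotation[OF q g outg inng] by metis
      then show ?thesis using reflection gi inversion_annulus[OF q(1)] by metis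
    next
      assume inn: "\<forall>e>0. near_inner q (\<lambda>z. cmod (f z) < q + e)"
      have "cmod (f z0) \<le> q"
        by (rule maximum_modulus_annulus[OF q hol out[rule_format] inn[rule_format] z0])
      then show ?thesis using fA[OF z0] by (simp add: annulus_def)
    qed
  qed
qed

section \<open>The Gaussian Laurent series\<close>

text \<open>The outcome is replaced by the coefficient sequence itself, with the coordinate
  projections \<open>\<lambda>n x. x n\<close> as random variables. Measurability of paths and zeros
  is then settled once, on sequence space.\<close>

lemma gaussian_laurent_canonical:
  "gaussian_laurent q r \<zeta> \<omega> = gaussian_laurent q r (\<lambda>n x. x n) (\<lambda>n. \<zeta> n \<omega>)"
proof -
  have eq: "laurent_term q r \<zeta> \<omega> = laurent_term q r (\<lambda>n x. x n) (\<lambda>n. \<zeta> n \<omega>)"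
    by (intro ext) (simp add: laurent_term_def)
  show ?thesis
    by (intro ext) (simp only: gaussian_laurent_def eq)
qed

text \<open>In t the power is nondecreasing for n >= 0 and decreasing for n < 0; the sum of the end
  values majorises both, so one bound serves both tails of a Laurent series.\<close>

lemma power_int_le_sum_endpoints:
  fixes t :: real
  assumes "0 < a" "a \<le> t" "t \<le> b"
  shows "t powi n \<le> a powi n + b powi n"
proof (cases "0 \<le> n")
  case True
  then have "t powi n \<le> b powi n" using assms by (intro power_int_mono) auto
  moreover have "0 \<le> a powi n" using assms by simp
  ultimately show ?thesis by linarith
next
  case False
  then have "t powi n \<le> a powi n" using assms by (intro power_int_antimono) auto
  moreover have "0 \<le> b powi n" using assms by simp
  ultimately show ?thesis by linarith
qed

lemma norm_laurent_term:
  "cmod (laurent_term q r \<zeta> \<omega> z n)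
     = cmod (\<zeta> n \<omega>) / \<bar>sqrt (1 + r * q powi (2 * n))\<bar> * cmod z powi n"
  by (simp add: laurent_term_def norm_mult norm_divide norm_power_int)

lemma norm_laurent_term_le:
  assumes "0 < a" "a \<le> cmod z" "cmod z \<le> b"
  shows "cmod (laurent_term q r \<zeta> \<omega> z n)
    \<le> cmod (laurent_term q r \<zeta> \<omega> (of_real a) n) + cmod (laurent_term q r \<zeta> \<omega> (of_real b) n)"
proof -
  have "\<bar>a\<bar> = a" "\<bar>b\<bar> = b" using assms by linarith+
  then show ?thesis
    unfolding norm_laurent_term distrib_left[symmetric] norm_of_real
    using power_int_le_sum_endpoints[OF assms] by (intro mult_left_mono) simp_all
qed

lemma norm_laurent_term_summable:
  "laurent_term q r \<zeta> \<omega> z summable_on UNIV \<longleftrightarrow> (\<lambda>n. cmod (laurent_term q r \<zeta> \<omega> z n)) summable_on UNIV"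
  by (rule summable_on_iff_abs_summable_on_complex)

lemma laurent_term_summable_between:
  assumes ab: "0 < a" "a \<le> cmod z" "cmod z \<le> b"
    and "laurent_term q r \<zeta> \<omega> (of_real a) summable_on UNIV"
    and "laurent_term q r \<zeta> \<omega> (of_real b) summable_on UNIV"
  shows "laurent_term q r \<zeta> \<omega> z summable_on UNIV"
proof -
  have "(\<lambda>n. cmod (laurent_term q r \<zeta> \<omega> (of_real a) n) + cmod (laurent_term q r \<zeta> \<omega> (of_real b) n)) summable_on UNIV"
    using assms(4,5) by (intro summable_on_add) (simp_all flip: norm_laurent_term_summable)
  then have "(\<lambda>n. cmod (laurent_term q r \<zeta> \<omega> z n)) summable_on UNIV"
    by (rule summable_on_comparison_test) (use norm_laurent_term_le[OF ab] in auto)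
  then show ?thesis by (simp add: norm_laurent_term_summable)
qed

text \<open>A small disc lies in a closed ring, and the terms at the two bounding radii give a
  summable majorant there. The M-test along finite index sets yields a locally uniform limit of
  holomorphic sums.\<close>

lemma holomorphic_gaussian_laurent:
  assumes q: "0 < q" "q < 1"
  shows "gaussian_laurent q r \<zeta> \<omega> holomorphic_on annulus q"
proof (cases "\<forall>w\<in>annulus q. laurent_term q r \<zeta> \<omega> w summable_on UNIV")
  case False
  then have "gaussian_laurent q r \<zeta> \<omega> = (\<lambda>_. 0)"
    by (intro ext) (simp only: gaussian_laurent_def if_False)
  then show ?thesis by simp
next
  case True
  then have eq: "gaussian_laurent q r \<zeta> \<omega> = (\<lambda>z. \<Sum>\<^sub>\<infinity>n. laurent_term q r \<zeta> \<omega> z n)"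
    by (auto simp: gaussian_laurent_def)
  have "\<exists>d>0. gaussian_laurent q r \<zeta> \<omega> holomorphic_on ball z d" if z: "z \<in> annulus q" for z
  proof -
    obtain d where d: "0 < d" "cball z d \<subseteq> annulus q"
      using open_annulus z open_contains_cball by blast
    obtain a b where ab: "q < a" "a \<le> b" "b < 1" "cball z d \<subseteq> {w. a \<le> cmod w \<and> cmod w \<le> b}"
      using compact_subset_annulus[OF q compact_cball d(2)] by blast
    have in_A: "complex_of_real a \<in> annulus q" "complex_of_real b \<in> annulus q"
      using ab q by (auto simp: annulus_def)
    let ?M = "\<lambda>n. cmod (laurent_term q r \<zeta> \<omega> (of_real a) n) + cmod (laurent_term q r \<zeta> \<omega> (of_real b) n)"
    have ulim: "uniform_limit (cball z d) (\<lambda>N w. \<Sum>n\<in>N. laurent_term q r \<zeta> \<omega> w n)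
      (\<lambda>w. \<Sum>\<^sub>\<infinity>n. laurent_term q r \<zeta> \<omega> w n) (finite_subsets_at_top UNIV)"
    proof (rule Weierstrass_m_test_general)
      show "?M summable_on UNIV"
        using True in_A by (intro summable_on_add) (simp_all flip: norm_laurent_term_summable)
      show "norm (laurent_term q r \<zeta> \<omega> w n) \<le> ?M n" if "w \<in> cball z d" for n w
        using ab q that by (intro norm_laurent_term_le) auto
    qed
    have "(\<lambda>w. \<Sum>n\<in>N. laurent_term q r \<zeta> \<omega> w n) holomorphic_on cball z d" for N
      unfolding laurent_term_def using d(2) annulus_nonzero[OF q(1)]
      by (intro holomorphic_intros) auto
    then have partial: "continuous_on (cball z d) (\<lambda>w. \<Sum>n\<in>N. laurent_term q r \<zeta> \<omega> w n) \<and>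
        (\<lambda>w. \<Sum>n\<in>N. laurent_term q r \<zeta> \<omega> w n) holomorphic_on ball z d" for N
      by (meson ball_subset_cball holomorphic_on_imp_continuous_on holomorphic_on_subset)
    have "(\<lambda>w. \<Sum>\<^sub>\<infinity>n. laurent_term q r \<zeta> \<omega> w n) holomorphic_on ball z d"
      by (rule holomorphic_uniform_limit[OF always_eventually[OF allI[OF partial]] ulim])
        (rule finite_subsets_at_top_neq_bot)
    then show ?thesis using d(1) by (auto simp: eq)
  qed
  then show ?thesis
    by (metis analytic_imp_holomorphic analytic_on_def)
qed

section \<open>Measurability of the random Laurent series\<close>

lemma measurable_laurent_term:
  "(\<lambda>x. laurent_term q r (\<lambda>n x. x n) x z n) \<in> borel_measurable (\<Pi>\<^sub>M n\<in>UNIV. borel)"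
  unfolding laurent_term_def by measurable

text \<open>Summability is boundedness of the sums of moduli over finite index sets. The integers
  have only countably many finite subsets, and a natural number serves as bound, so all quantifiers
  are countable.\<close>

lemma laurent_term_summable_event:
  "{x. laurent_term q r (\<lambda>n x. x n) x z summable_on UNIV} \<in> sets (\<Pi>\<^sub>M n\<in>UNIV. borel)"
proof -
  have [measurable]: "countable (Collect finite :: int set set)"
    using countable_Collect_finite[where 'a = int] by simp
  note measurable_laurent_term[measurable]
  have "{x. laurent_term q r (\<lambda>n x. x n) x z summable_on UNIV}
      = {x \<in> space (\<Pi>\<^sub>M n\<in>UNIV. borel). \<exists>N::nat. \<forall>I\<in>Collect finite.
           (\<Sum>n\<in>I. cmod (laurent_term q r (\<lambda>n x. x n) x z n)) \<le> real N}"
  proof (intro Collect_cong)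
    fix x
    let ?S = "\<lambda>I. \<Sum>n\<in>I. cmod (laurent_term q r (\<lambda>n x. x n) x z n)"
    have "laurent_term q r (\<lambda>n x. x n) x z summable_on UNIV \<longleftrightarrow> bdd_above (?S ` {I. I \<subseteq> UNIV \<and> finite I})"
      unfolding norm_laurent_term_summable by (rule abs_summable_iff_bdd_above)
    also have "\<dots> \<longleftrightarrow> (\<exists>N::nat. \<forall>I\<in>Collect finite. ?S I \<le> real N)"
    proof
      assume "bdd_above (?S ` {I. I \<subseteq> UNIV \<and> finite I})"
      then obtain b where b: "\<And>I. finite I \<Longrightarrow> ?S I \<le> b" by (auto simp: bdd_above_def)
      obtain N where "b \<le> real N" using real_arch_simple by blast
      then show "\<exists>N::nat. \<forall>I\<in>Collect finite. ?S I \<le> real N"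
        using b order_trans by blast
    qed (auto simp: bdd_above_def)
    finally show "laurent_term q r (\<lambda>n x. x n) x z summable_on UNIV \<longleftrightarrow>
        x \<in> space (\<Pi>\<^sub>M n\<in>UNIV. borel) \<and> (\<exists>N::nat. \<forall>I\<in>Collect finite. ?S I \<le> real N)"
      by (simp add: space_PiM)
  qed
  also have "\<dots> \<in> sets (\<Pi>\<^sub>M n\<in>UNIV. borel)"
    by measurable
  finally show ?thesis .
qed

text \<open>Convergence at two positive radii implies convergence on the ring between them, so
  rational radii decide it on the whole annulus.\<close>

lemma laurent_convergence_event:
  assumes q: "0 < q" "q < 1"
  shows "{x. \<forall>w\<in>annulus q. laurent_term q r (\<lambda>n x. x n) x w summable_on UNIV} \<in> sets (\<Pi>\<^sub>M n\<in>UNIV. borel)"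
proof -
  let ?s = "\<lambda>x w. laurent_term q r (\<lambda>n x. x n) x w summable_on UNIV"
  have "(\<forall>w\<in>annulus q. ?s x w) \<longleftrightarrow> (\<forall>t\<in>{t\<in>\<rat>. q < t \<and> t < 1}. ?s x (complex_of_real t))" for x
  proof (intro iffI ballI)
    fix t :: real assume "\<forall>w\<in>annulus q. ?s x w" "t \<in> {t\<in>\<rat>. q < t \<and> t < 1}"
    then show "?s x (complex_of_real t)" using q by (auto simp: annulus_def)
  next
    fix w assume *: "\<forall>t\<in>{t\<in>\<rat>. q < t \<and> t < 1}. ?s x (complex_of_real t)" and w: "w \<in> annulus q"
    obtain a where "a \<in> \<rat>" "q < a" "a < cmod w"
      using Rats_dense_in_real w by (auto simp: annulus_def)
    moreover obtain b where "b \<in> \<rat>" "cmod w < b" "b < 1"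
      using Rats_dense_in_real w by (auto simp: annulus_def)
    ultimately show "?s x w"
      using * q by (intro laurent_term_summable_between[of a w b]) auto
  qed
  then have "{x. \<forall>w\<in>annulus q. ?s x w}
     = {x \<in> space (\<Pi>\<^sub>M n\<in>UNIV. borel). \<forall>t\<in>{t\<in>\<rat>. q < t \<and> t < 1}. ?s x (complex_of_real t)}"
    by (simp add: space_PiM)
  also have "\<dots> \<in> sets (\<Pi>\<^sub>M n\<in>UNIV. borel)"
  proof -
    have [measurable]: "Measurable.pred (\<Pi>\<^sub>M n\<in>UNIV. borel) (\<lambda>x. ?s x w)" for w
      using laurent_term_summable_event by (simp add: pred_def space_PiM)
    have "countable {t::real\<in>\<rat>. q < t \<and> t < 1}"
      by (rule countable_subset[OF _ countable_rat]) auto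
    then show ?thesis by measurable
  qed
  finally show ?thesis .
qed

text \<open>An unconditional sum over the integers thus becomes the limit of a sequence, and
  sequential limits preserve measurability.\<close>

lemma filterlim_symmetric_intervals:
  "filterlim (\<lambda>N. {- int N..int N}) (finite_subsets_at_top UNIV) sequentially"
  unfolding filterlim_finite_subsets_at_top
proof (intro allI impI)
  fix X :: "int set" assume X: "finite X \<and> X \<subseteq> UNIV"
  have "X \<subseteq> {- int N..int N}" if "N \<ge> nat (Max (insert 0 (abs ` X)))" for N
  proof
    fix x assume "x \<in> X"
    then have "\<bar>x\<bar> \<le> Max (insert 0 (abs ` X))" using X by (intro Max_ge) auto
    then show "x \<in> {- int N..int N}" using that by auto
  qed
  then show "\<forall>\<^sub>F N in sequentially. finite {- int N..int N} \<and> X \<subseteq> {- int N..int N} \<and> {- int N..int N} \<subseteq> UNIV"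
    by (intro eventually_sequentiallyI[of "nat (Max (insert 0 (abs ` X)))"]) simp
qed

lemma measurable_gaussian_laurent:
  assumes q: "0 < q" "q < 1" and z: "z \<in> annulus q"
  shows "(\<lambda>x. gaussian_laurent q r (\<lambda>n x. x n) x z) \<in> borel_measurable (\<Pi>\<^sub>M n\<in>UNIV. borel)"
proof (rule borel_measurable_LIMSEQ_metric)
  let ?P = "\<lambda>x. \<forall>w\<in>annulus q. laurent_term q r (\<lambda>n x. x n) x w summable_on UNIV"
  let ?f = "\<lambda>N x. if ?P x then \<Sum>n\<in>{- int N..int N}. laurent_term q r (\<lambda>n x. x n) x z n else 0"
  show "?f N \<in> borel_measurable (\<Pi>\<^sub>M n\<in>UNIV. borel)" for N
    using laurent_convergence_event[OF q, of r] measurable_laurent_term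
    by (intro measurable_If borel_measurable_sum) (auto simp: space_PiM)
  show "(\<lambda>N. ?f N x) \<longlonglongrightarrow> gaussian_laurent q r (\<lambda>n x. x n) x z" for x
  proof (cases "?P x")
    case True
    then have "(laurent_term q r (\<lambda>n x. x n) x z has_sum gaussian_laurent q r (\<lambda>n x. x n) x z) UNIV"
      unfolding gaussian_laurent_def if_P[OF True] using z by (intro has_sum_infsum) blast
    then show ?thesis
      unfolding has_sum_def if_P[OF True] by (rule filterlim_compose[OF _ filterlim_symmetric_intervals])
  next
    case False
    show ?thesis unfolding gaussian_laurent_def if_not_P[OF False] by (rule tendsto_const)
  qed
qed

section \<open>Action of automorphisms on the series and its law\<close>

text \<open>Since \<open>f\<close> permutes the annulus and the factors do not vanish, the two
  series converge throughout the annulus for the same outcome or not at all. The default path 0 is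
  thus taken on both sides together.\<close>

lemma gaussian_laurent_transform:
  assumes f: "bij_betw f (annulus q) (annulus q)" and \<sigma>: "bij \<sigma>"
    and nz: "\<And>z. z \<in> annulus q \<Longrightarrow> g z \<noteq> 0" "k \<noteq> 0"
    and trans: "\<And>z n. z \<in> annulus q \<Longrightarrow>
      g z * laurent_term q r \<zeta> \<omega> (f z) (\<sigma> n) = k * laurent_term q r' \<xi> \<omega> z n"
    and z: "z \<in> annulus q"
  shows "g z * gaussian_laurent q r \<zeta> \<omega> (f z) = k * gaussian_laurent q r' \<xi> \<omega> z"
proof -
  have summable: "laurent_term q r \<zeta> \<omega> (f w) summable_on UNIV \<longleftrightarrow> laurent_term q r' \<xi> \<omega> w summable_on UNIV"
    if w: "w \<in> annulus q" for w
  proof -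
    have "laurent_term q r \<zeta> \<omega> (f w) summable_on UNIV
        \<longleftrightarrow> (\<lambda>n. laurent_term q r \<zeta> \<omega> (f w) (\<sigma> n)) summable_on UNIV"
      by (rule summable_on_reindex_bij_betw[OF \<sigma>, symmetric])
    also have "\<dots> \<longleftrightarrow> (\<lambda>n. g w * laurent_term q r \<zeta> \<omega> (f w) (\<sigma> n)) summable_on UNIV"
      by (rule summable_on_cmult_right'[OF nz(1)[OF w], symmetric])
    also have "\<dots> \<longleftrightarrow> laurent_term q r' \<xi> \<omega> w summable_on UNIV"
      unfolding trans[OF w] by (rule summable_on_cmult_right'[OF nz(2)])
    finally show ?thesis .
  qed
  have "(\<forall>w\<in>annulus q. laurent_term q r \<zeta> \<omega> w summable_on UNIV)
      \<longleftrightarrow> (\<forall>w\<in>f ` annulus q. laurent_term q r \<zeta> \<omega> w summable_on UNIV)"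
    using f by (simp add: bij_betw_def)
  also have "\<dots> \<longleftrightarrow> (\<forall>w\<in>annulus q. laurent_term q r' \<xi> \<omega> w summable_on UNIV)"
    using summable by auto
  finally have conv: "(\<forall>w\<in>annulus q. laurent_term q r \<zeta> \<omega> w summable_on UNIV)
      \<longleftrightarrow> (\<forall>w\<in>annulus q. laurent_term q r' \<xi> \<omega> w summable_on UNIV)" .
  have "g z * (\<Sum>\<^sub>\<infinity>n. laurent_term q r \<zeta> \<omega> (f z) n) = g z * (\<Sum>\<^sub>\<infinity>n. laurent_term q r \<zeta> \<omega> (f z) (\<sigma> n))"
    by (simp only: infsum_reindex_bij_betw[OF \<sigma>])
  also have "\<dots> = (\<Sum>\<^sub>\<infinity>n. g z * laurent_term q r \<zeta> \<omega> (f z) (\<sigma> n))"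
    by (rule infsum_cmult_right'[symmetric])
  also have "\<dots> = k * (\<Sum>\<^sub>\<infinity>n. laurent_term q r' \<xi> \<omega> z n)"
    unfolding trans[OF z] by (rule infsum_cmult_right')
  finally show ?thesis
    unfolding gaussian_laurent_def conv by simp
qed

lemma laurent_term_rotation:
  "s * laurent_term q r \<zeta> \<omega> (c * z) n = laurent_term q r (\<lambda>n \<omega>. (s * c powi n) * \<zeta> n \<omega>) \<omega> z n"
  by (simp add: laurent_term_def power_int_mult_distrib mult_ac)

text \<open>With p = q^(n+1) the radicands are (p^2 + r)/p^2 and (p^2 + r)/r, so both sides equal
  sqrt q / sqrt (p^2 + r).\<close>

lemma sqrt_weight_reflection:
  fixes q r :: real
  assumes q: "0 < q" and r: "0 < r"
  shows "sqrt q * q powi (- n - 1) / sqrt (1 + r * q powi (2 * (- n - 1)))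
    = sqrt (q / r) / sqrt (1 + q\<^sup>2 / r * q powi (2 * n))"
proof -
  define p where "p = q powi (n + 1)"
  have p: "0 < p" using q by (simp add: p_def)
  have 1: "q powi (- n - 1) = 1 / p"
  proof -
    have "- n - 1 = - (n + 1)" by simp
    then show ?thesis by (simp only: p_def power_int_minus inverse_eq_divide)
  qed
  have 2: "q powi (2 * (- n - 1)) = 1 / p\<^sup>2"
  proof -
    have "2 * (- n - 1) = (- n - 1) + (- n - 1)" by simp
    moreover have "q powi ((- n - 1) + (- n - 1)) = q powi (- n - 1) * q powi (- n - 1)"
      using q by (intro power_int_add) simp
    ultimately have "q powi (2 * (- n - 1)) = q powi (- n - 1) * q powi (- n - 1)"
      by simp
    then show ?thesis by (simp add: 1 power2_eq_square)
  qed
  have 3: "q\<^sup>2 * q powi (2 * n) = p\<^sup>2"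
  proof -
    have "p\<^sup>2 = q powi (n + 1 + (n + 1))" using q by (simp add: p_def power2_eq_square flip: power_int_add)
    also have "\<dots> = q powi (2 + 2 * n)" by (simp add: algebra_simps)
    also have "\<dots> = q powi 2 * q powi (2 * n)" using q by (intro power_int_add) simp
    finally show ?thesis by simp
  qed
  have "1 + r * (1 / p\<^sup>2) = (p\<^sup>2 + r) / p\<^sup>2" using p by (simp add: field_simps)
  then have "sqrt (1 + r * q powi (2 * (- n - 1))) = sqrt (p\<^sup>2 + r) / p"
    unfolding 2 using p by (simp add: real_sqrt_divide)
  moreover have "1 + q\<^sup>2 / r * q powi (2 * n) = (p\<^sup>2 + r) / r"
    using r by (simp add: 3[symmetric] field_simps)
  then have "sqrt (1 + q\<^sup>2 / r * q powi (2 * n)) = sqrt (p\<^sup>2 + r) / sqrt r"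
    by (simp add: real_sqrt_divide)
  ultimately show ?thesis
    unfolding 1 using p r by (simp add: real_sqrt_divide)
qed

text \<open>The free constants \<open>c\<close> and \<open>d\<close> cover every reflection of the
  annulus and either branch of its derivative root; they end up in the coefficients.\<close>

lemma laurent_term_reflection:
  assumes q: "0 < q" and r: "0 < r" and z: "z \<noteq> 0"
  shows "(d * complex_of_real (sqrt q) / z) * laurent_term q r \<zeta> \<omega> (c * inversion q z) (- n - 1)
    = complex_of_real (sqrt (q / r)) * laurent_term q (q\<^sup>2 / r) (\<lambda>n \<omega>. (d * c powi (- n - 1)) * \<zeta> (- n - 1) \<omega>) \<omega> z n"
proof -
  have z': "inverse z * inverse z powi (- n - 1) = z powi n"
    using z by (simp add: power_int_diff power_int_inverse power_int_minus field_simps)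
  have w: "complex_of_real (sqrt q) * complex_of_real q powi (- n - 1) / complex_of_real (sqrt (1 + r * q powi (2 * (- n - 1))))
    = complex_of_real (sqrt (q / r)) / complex_of_real (sqrt (1 + q\<^sup>2 / r * q powi (2 * n)))"
    unfolding of_real_power_int[symmetric] of_real_mult[symmetric] of_real_divide[symmetric] sqrt_weight_reflection[OF q r] ..
  have assoc: "D * C * x * y * (K / W) = K * ((D * C) * x * (y / W))" for D C x y K W :: complex
    by simp
  have "(d * complex_of_real (sqrt q) / z) * laurent_term q r \<zeta> \<omega> (c * inversion q z) (- n - 1)
    = d * c powi (- n - 1) * \<zeta> (- n - 1) \<omega> * (inverse z * inverse z powi (- n - 1)) *
      (complex_of_real (sqrt q) * complex_of_real q powi (- n - 1) / complex_of_real (sqrt (1 + r * q powi (2 * (- n - 1)))))"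
    unfolding laurent_term_def inversion_def divide_inverse power_int_mult_distrib by (simp only: mult_ac)
  also have "\<dots> = complex_of_real (sqrt (q / r)) * laurent_term q (q\<^sup>2 / r) (\<lambda>n \<omega>. (d * c powi (- n - 1)) * \<zeta> (- n - 1) \<omega>) \<omega> z n"
    unfolding z' w laurent_term_def by (rule assoc)
  finally show ?thesis .
qed

text \<open>An injective holomorphic map on an open set has a holomorphic inverse, which agrees with
  \<open>inv_into A f\<close> on \<open>A\<close>.\<close>

lemma conformal_automorphism_continuous_inv:
  assumes f: "conformal_automorphism A f" and A: "open A"
  shows "continuous_on A (inv_into A f)"
proof -
  have hol: "f holomorphic_on A" and bij: "bij_betw f A A"
    using f by (auto simp: conformal_automorphism_def)
  obtain g where g: "g holomorphic_on (f ` A)" "\<And>z. z \<in> A \<Longrightarrow> g (f z) = z"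
    using holomorphic_has_inverse[OF hol A bij_betw_imp_inj_on[OF bij]] by metis
  have im: "f ` A = A" using bij by (rule bij_betw_imp_surj_on)
  have "inv_into A f w = g w" if "w \<in> A" for w
    using g(2)[of "inv_into A f w"] that bij_betw_inv_into_right[OF bij that] inv_into_into[of w f A] im
    by simp
  then show ?thesis
    using holomorphic_on_imp_continuous_on[OF g(1)] im by (simp cong: continuous_on_cong)
qed

text \<open>By \<open>eq\<close> the transformed objects are functionals of \<open>\<xi>\<close>;
  the right sides are the same functionals of \<open>\<zeta>\<close>, a family of equal law. For the
  zeros, \<open>g\<close> and \<open>k\<close> drop out because they do not vanish.\<close>

lemma gaussian_laurent_same_law:
  assumes q: "0 < q" "q < 1"
    and iid: "iid_std_complex_gaussian M \<zeta>" "iid_std_complex_gaussian M \<xi>"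
    and f: "conformal_automorphism (annulus q) f"
    and nz: "\<And>z. z \<in> annulus q \<Longrightarrow> g z \<noteq> 0" "k \<noteq> 0"
    and eq: "\<And>\<omega> z. z \<in> annulus q \<Longrightarrow>
      g z * gaussian_laurent q r \<zeta> \<omega> (f z) = k * gaussian_laurent q r' \<xi> \<omega> z"
  shows "same_law_process M (annulus q)
      (\<lambda>\<omega> z. g z * gaussian_laurent q r \<zeta> \<omega> (f z)) (\<lambda>\<omega> z. k * gaussian_laurent q r' \<zeta> \<omega> z)"
    and "same_law_point_process M (annulus q)
      (\<lambda>\<omega>. pullback_measure (annulus q) f (zero_process q r \<zeta> \<omega>)) (zero_process q r' \<zeta>)"
proof -
  let ?A = "annulus q" and ?N = "\<Pi>\<^sub>M n\<in>UNIV. borel :: complex measure"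
  let ?X = "\<lambda>x. gaussian_laurent q r' (\<lambda>n x. x n) x"
  let ?\<Phi> = "\<lambda>x. restrict (\<lambda>z. k * ?X x z) ?A"
  have "?\<Phi> \<in> ?N \<rightarrow>\<^sub>M (\<Pi>\<^sub>M z\<in>?A. borel)"
    using measurable_gaussian_laurent[OF q]
    by (intro measurable_restrict borel_measurable_times borel_measurable_const) auto
  then have "same_law M (\<Pi>\<^sub>M z\<in>?A. borel) (\<lambda>\<omega>. ?\<Phi> (\<lambda>n. \<xi> n \<omega>)) (\<lambda>\<omega>. ?\<Phi> (\<lambda>n. \<zeta> n \<omega>))"
    by (rule same_law_iid_std_complex_gaussian[OF iid(2,1)])
  moreover have "(\<lambda>\<omega>. ?\<Phi> (\<lambda>n. \<xi> n \<omega>)) = (\<lambda>\<omega>. restrict (\<lambda>z. g z * gaussian_laurent q r \<zeta> \<omega> (f z)) ?A)"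
    by (intro ext restrict_ext) (simp add: eq gaussian_laurent_canonical[of _ _ \<xi>])
  ultimately show "same_law_process M ?A
      (\<lambda>\<omega> z. g z * gaussian_laurent q r \<zeta> \<omega> (f z)) (\<lambda>\<omega> z. k * gaussian_laurent q r' \<zeta> \<omega> z)"
    unfolding same_law_process_def gaussian_laurent_canonical[of _ r' \<zeta>] by simp
  have "random_analytic ?N ?A ?X"
    by unfold_locales
       (use open_annulus connected_annulus_complex holomorphic_gaussian_laurent[OF q] measurable_gaussian_laurent[OF q] in auto)
  then have "(\<lambda>x. zero_measure ?A (?X x)) \<in> ?N \<rightarrow>\<^sub>M measure_algebra (restrict_space borel ?A)"
    by (rule random_analytic.measurable_zero_measure)
  then have "same_law M (measure_algebra (restrict_space borel ?A))
      (\<lambda>\<omega>. zero_measure ?A (?X (\<lambda>n. \<xi> n \<omega>))) (\<lambda>\<omega>. zero_measure ?A (?X (\<lambda>n. \<zeta> n \<omega>)))"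
    by (rule same_law_iid_std_complex_gaussian[OF iid(2,1)])
  moreover have "zero_measure ?A (?X (\<lambda>n. \<xi> n \<omega>)) = pullback_measure ?A f (zero_process q r \<zeta> \<omega>)" for \<omega>
  proof -
    have "pullback_measure ?A f (zero_process q r \<zeta> \<omega>) = zero_measure ?A (\<lambda>z. gaussian_laurent q r \<zeta> \<omega> (f z))"
      unfolding zero_process_def using f conformal_automorphism_continuous_inv[OF f open_annulus]
      by (intro pullback_zero_measure) (auto simp: conformal_automorphism_def)
    also have "\<dots> = zero_measure ?A (gaussian_laurent q r' \<xi> \<omega>)"
      using eq nz by (intro zero_measure_cong) (metis mult_eq_0_iff)
    finally show ?thesis by (simp add: gaussian_laurent_canonical[of _ _ \<xi>])
  qed
  ultimately show "same_law_point_process M ?A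
      (\<lambda>\<omega>. pullback_measure ?A f (zero_process q r \<zeta> \<omega>)) (zero_process q r' \<zeta>)"
    unfolding same_law_point_process_def zero_process_def gaussian_laurent_canonical[of _ r' \<zeta>] by simp
qed

text \<open>A rotation multiplies the n-th term by c^n and leaves its weight alone, so
  \<open>r\<close> does not change.\<close>

lemma gaussian_laurent_rotation_law:
  assumes q: "0 < q" "q < 1" and iid: "iid_std_complex_gaussian M \<zeta>"
    and f: "conformal_automorphism (annulus q) f"
    and c: "cmod c = 1" "\<And>z. z \<in> annulus q \<Longrightarrow> f z = c * z"
    and s: "cmod s = 1" "\<And>z. z \<in> annulus q \<Longrightarrow> g z = s"
  shows "same_law_process M (annulus q)
      (\<lambda>\<omega> z. g z * gaussian_laurent q r \<zeta> \<omega> (f z)) (gaussian_laurent q r \<zeta>)"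
    and "same_law_point_process M (annulus q)
      (\<lambda>\<omega>. pullback_measure (annulus q) f (zero_process q r \<zeta> \<omega>)) (zero_process q r \<zeta>)"
proof -
  let ?\<xi> = "\<lambda>n \<omega>. (s * c powi n) * \<zeta> n \<omega>"
  have iid': "iid_std_complex_gaussian M ?\<xi>"
    using iid_std_complex_gaussian_reindex[OF iid, of id "\<lambda>n. s * c powi n"] c(1) s(1)
    by (simp add: norm_mult norm_power_int)
  have nz: "g z \<noteq> 0" if "z \<in> annulus q" for z using s that by auto
  have eq: "g z * gaussian_laurent q r \<zeta> \<omega> (f z) = 1 * gaussian_laurent q r ?\<xi> \<omega> z"
    if z: "z \<in> annulus q" for \<omega> z
    by (rule gaussian_laurent_transform[where \<sigma> = id, OF _ _ nz _ _ z])
       (use f in \<open>auto simp: conformal_automorphism_def c(2) s(2) laurent_term_rotation\<close>)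
  show "same_law_process M (annulus q)
      (\<lambda>\<omega> z. g z * gaussian_laurent q r \<zeta> \<omega> (f z)) (gaussian_laurent q r \<zeta>)"
    using gaussian_laurent_same_law(1)[OF q iid iid' f nz _ eq] by simp
  show "same_law_point_process M (annulus q)
      (\<lambda>\<omega>. pullback_measure (annulus q) f (zero_process q r \<zeta> \<omega>)) (zero_process q r \<zeta>)"
    using gaussian_laurent_same_law(2)[OF q iid iid' f nz _ eq] by simp
qed

lemma gaussian_laurent_reflection_law:
  assumes q: "0 < q" "q < 1" and r: "0 < r" and iid: "iid_std_complex_gaussian M \<zeta>"
    and f: "conformal_automorphism (annulus q) f"
    and c: "cmod c = 1" "\<And>z. z \<in> annulus q \<Longrightarrow> f z = c * inversion q z"
    and d: "cmod d = 1" "\<And>z. z \<in> annulus q \<Longrightarrow> g z = d * complex_of_real (sqrt q) / z"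
  shows "same_law_process M (annulus q)
      (\<lambda>\<omega> z. g z * gaussian_laurent q r \<zeta> \<omega> (f z))
      (\<lambda>\<omega> z. complex_of_real (sqrt (q / r)) * gaussian_laurent q (q\<^sup>2 / r) \<zeta> \<omega> z)"
    and "same_law_point_process M (annulus q)
      (\<lambda>\<omega>. pullback_measure (annulus q) f (zero_process q r \<zeta> \<omega>)) (zero_process q (q\<^sup>2 / r) \<zeta>)"
proof -
  let ?\<sigma> = "\<lambda>n::int. - n - 1" and ?k = "complex_of_real (sqrt (q / r))"
  let ?\<xi> = "\<lambda>n \<omega>. (d * c powi (- n - 1)) * \<zeta> (- n - 1) \<omega>"
  have \<sigma>: "bij ?\<sigma>" by (rule o_bij[of ?\<sigma>]) auto
  have iid': "iid_std_complex_gaussian M ?\<xi>"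
    using iid_std_complex_gaussian_reindex[OF iid bij_is_inj[OF \<sigma>], of "\<lambda>n. d * c powi (- n - 1)"] c(1) d(1)
    by (simp add: norm_mult norm_power_int)
  have nz: "g z \<noteq> 0" if "z \<in> annulus q" for z
    using d q that annulus_nonzero[OF q(1) that] by auto
  have k: "?k \<noteq> 0" using q r by simp
  have eq: "g z * gaussian_laurent q r \<zeta> \<omega> (f z) = ?k * gaussian_laurent q (q\<^sup>2 / r) ?\<xi> \<omega> z"
    if z: "z \<in> annulus q" for \<omega> z
  proof (rule gaussian_laurent_transform[OF _ \<sigma> nz k _ z])
    show "bij_betw f (annulus q) (annulus q)" using f by (simp add: conformal_automorphism_def)
    show "g w * laurent_term q r \<zeta> \<omega> (f w) (- n - 1) = ?k * laurent_term q (q\<^sup>2 / r) ?\<xi> \<omega> w n"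
      if w: "w \<in> annulus q" for w n
      unfolding c(2)[OF w] d(2)[OF w] by (rule laurent_term_reflection[OF q(1) r annulus_nonzero[OF q(1) w]])
  qed
  show "same_law_process M (annulus q)
      (\<lambda>\<omega> z. g z * gaussian_laurent q r \<zeta> \<omega> (f z)) (\<lambda>\<omega> z. ?k * gaussian_laurent q (q\<^sup>2 / r) \<zeta> \<omega> z)"
    by (rule gaussian_laurent_same_law(1)[OF q iid iid' f nz k eq])
  show "same_law_point_process M (annulus q)
      (\<lambda>\<omega>. pullback_measure (annulus q) f (zero_process q r \<zeta> \<omega>)) (zero_process q (q\<^sup>2 / r) \<zeta>)"
    by (rule gaussian_laurent_same_law(2)[OF q iid iid' f nz k eq])
qed

section \<open>Single-valued branches of the root of the derivative\<close>

text \<open>At most two values are possible, and a continuous function with finite range on a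
  connected set is constant.\<close>

lemma continuous_square_constant:
  fixes h :: "complex \<Rightarrow> complex"
  assumes S: "connected S" "S \<noteq> {}" and h: "continuous_on S h" "\<And>z. z \<in> S \<Longrightarrow> (h z)\<^sup>2 = a"
  obtains s where "s\<^sup>2 = a" "\<And>z. z \<in> S \<Longrightarrow> h z = s"
proof -
  obtain z0 where z0: "z0 \<in> S" using S by blast
  have "h ` S \<subseteq> {h z0, - h z0}"
    using h(2) z0 by (auto simp: power2_eq_iff) (metis power2_eq_iff)
  then have "finite (h ` S)" by (rule finite_subset) simp
  then have "h constant_on S"
    using continuous_finite_range_constant[OF S(1) h(1)] by blast
  then show ?thesis
    using that[of "h z0"] h(2)[OF z0] z0 by (metis constant_on_def)
qed

lemma deriv_transform_open:
  assumes "open A" "z \<in> A" "\<And>w. w \<in> A \<Longrightarrow> f w = h w" "(h has_field_derivative h') (at z)"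
  shows "deriv f z = h'"
  using assms by (intro DERIV_imp_deriv has_field_derivative_transform_within_open[of h h' z A f]) auto

lemma deriv_sqrt_branch_rotation:
  assumes q: "0 < q" "q < 1" and c: "cmod c = 1" "\<And>z. z \<in> annulus q \<Longrightarrow> f z = c * z"
  shows "\<exists>g. deriv_sqrt_branch (annulus q) f g"
    and "deriv_sqrt_branch (annulus q) f g \<Longrightarrow> \<exists>s. cmod s = 1 \<and> (\<forall>z\<in>annulus q. g z = s)"
proof -
  have deriv: "deriv f z = c" if "z \<in> annulus q" for z
    by (rule deriv_transform_open[OF open_annulus that c(2)]) (auto intro!: derivative_eq_intros)
  show "\<exists>g. deriv_sqrt_branch (annulus q) f g"
    by (rule exI[of _ "\<lambda>_. csqrt c"]) (simp add: deriv_sqrt_branch_def deriv)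
  assume "deriv_sqrt_branch (annulus q) f g"
  then have cont: "continuous_on (annulus q) g" and sq: "\<And>z. z \<in> annulus q \<Longrightarrow> (g z)\<^sup>2 = c"
    by (auto simp: deriv_sqrt_branch_def deriv holomorphic_on_imp_continuous_on)
  obtain s where s: "s\<^sup>2 = c" "\<And>z. z \<in> annulus q \<Longrightarrow> g z = s"
    using continuous_square_constant[OF connected_annulus_complex annulus_nonempty[OF q] cont sq] by blast
  have "(cmod s)\<^sup>2 = 1\<^sup>2" unfolding one_power2 using c(1) s(1) by (metis norm_power)
  then have "cmod s = 1" by (rule power2_eq_imp_eq) simp_all
  then show "\<exists>s. cmod s = 1 \<and> (\<forall>z\<in>annulus q. g z = s)" using s by blast
qed

text \<open>The derivative is -c q/z^2; multiplying a branch by z / sqrt q leaves a continuous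
  square root of the constant -c, hence a constant of modulus 1.\<close>

lemma deriv_sqrt_branch_reflection:
  assumes q: "0 < q" "q < 1" and c: "cmod c = 1" "\<And>z. z \<in> annulus q \<Longrightarrow> f z = c * inversion q z"
  shows "\<exists>g. deriv_sqrt_branch (annulus q) f g"
    and "deriv_sqrt_branch (annulus q) f g \<Longrightarrow>
      \<exists>d. cmod d = 1 \<and> (\<forall>z\<in>annulus q. g z = d * complex_of_real (sqrt q) / z)"
proof -
  note nz = annulus_nonzero[OF q(1)]
  have sq: "(complex_of_real (sqrt q))\<^sup>2 = complex_of_real q" "complex_of_real (sqrt q) \<noteq> 0"
    using q by (simp_all flip: of_real_power)
  have deriv: "deriv f z = - c * complex_of_real q / z\<^sup>2" if "z \<in> annulus q" for z
    by (rule deriv_transform_open[OF open_annulus that c(2)])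
       (use nz[OF that] in \<open>auto simp: inversion_def power2_eq_square intro!: derivative_eq_intros\<close>)
  show "\<exists>g. deriv_sqrt_branch (annulus q) f g"
    by (rule exI[of _ "\<lambda>z. csqrt (- c) * complex_of_real (sqrt q) / z"])
       (use nz in \<open>auto simp: deriv_sqrt_branch_def deriv power_mult_distrib power_divide sq intro!: holomorphic_intros\<close>)
  assume g: "deriv_sqrt_branch (annulus q) f g"
  have "g holomorphic_on annulus q" using g by (simp add: deriv_sqrt_branch_def)
  then have "(\<lambda>z. g z * z / complex_of_real (sqrt q)) holomorphic_on annulus q"
    using sq(2) by (intro holomorphic_intros)
  then have cont: "continuous_on (annulus q) (\<lambda>z. g z * z / complex_of_real (sqrt q))"
    by (rule holomorphic_on_imp_continuous_on)
  have square: "(g z * z / complex_of_real (sqrt q))\<^sup>2 = - c" if "z \<in> annulus q" for z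
    using g that nz[OF that] q by (simp add: deriv_sqrt_branch_def deriv power_mult_distrib power_divide sq)
  obtain d where d: "d\<^sup>2 = - c" "\<And>z. z \<in> annulus q \<Longrightarrow> g z * z / complex_of_real (sqrt q) = d"
    using continuous_square_constant[OF connected_annulus_complex annulus_nonempty[OF q] cont square] by blast
  have "(cmod d)\<^sup>2 = 1\<^sup>2" unfolding one_power2 using c(1) d(1) by (metis norm_minus_cancel norm_power)
  then have "cmod d = 1" by (rule power2_eq_imp_eq) simp_all
  moreover have "g z = d * complex_of_real (sqrt q) / z" if "z \<in> annulus q" for z
    using d(2)[OF that] nz[OF that] sq(2) by (simp add: field_simps)
  ultimately show "\<exists>d. cmod d = 1 \<and> (\<forall>z\<in>annulus q. g z = d * complex_of_real (sqrt q) / z)" by blast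
qed

lemma gaussian_laurent_conformal_invariance:
  assumes q: "0 < q" "q < 1" and iid: "iid_std_complex_gaussian M \<zeta>"
    and f: "conformal_automorphism (annulus q) f"
  shows "invariant_GAF M (annulus q) (gaussian_laurent q q \<zeta>) f
    \<and> invariant_point_process M (annulus q) (zero_process q q \<zeta>) f"
proof (rule conformal_automorphism_annulus[OF q f])
  fix c assume c: "cmod c = 1" "\<And>z. z \<in> annulus q \<Longrightarrow> f z = c * z"
  have "same_law_process M (annulus q) (\<lambda>\<omega> z. g z * gaussian_laurent q q \<zeta> \<omega> (f z)) (gaussian_laurent q q \<zeta>)"
    if g: "deriv_sqrt_branch (annulus q) f g" for g
  proof -
    obtain s where "cmod s = 1" "\<And>z. z \<in> annulus q \<Longrightarrow> g z = s"
      using deriv_sqrt_branch_rotation(2)[OF q c(1) _ g] c(2) by blast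
    then show ?thesis
      using c by (intro gaussian_laurent_rotation_law(1)[OF q iid f])
  qed
  moreover have "\<exists>g. deriv_sqrt_branch (annulus q) f g"
    using deriv_sqrt_branch_rotation(1)[OF q c(1)] c(2) by blast
  \<comment> \<open>The zeros do not see the factor \<open>g\<close>, so the constant 1 may be taken
    for it.\<close>
  moreover have "same_law_point_process M (annulus q)
      (\<lambda>\<omega>. pullback_measure (annulus q) f (zero_process q q \<zeta> \<omega>)) (zero_process q q \<zeta>)"
    by (rule gaussian_laurent_rotation_law(2)[OF q iid f, where c = c and s = 1 and g = "\<lambda>_. 1"]) (simp_all add: c)
  ultimately show ?thesis
    by (simp add: invariant_GAF_def invariant_point_process_def)
next
  fix c assume c: "cmod c = 1" "\<And>z. z \<in> annulus q \<Longrightarrow> f z = c * inversion q z"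
  \<comment> \<open>At r = q the new parameter is q again and the scalar factor becomes 1.\<close>
  have qq: "q\<^sup>2 / q = q" "complex_of_real (sqrt (q / q)) = 1" using q by (simp_all add: power2_eq_square)
  note law = gaussian_laurent_reflection_law[OF q q(1) iid f, unfolded qq mult_1]
  have "same_law_process M (annulus q) (\<lambda>\<omega> z. g z * gaussian_laurent q q \<zeta> \<omega> (f z)) (gaussian_laurent q q \<zeta>)"
    if g: "deriv_sqrt_branch (annulus q) f g" for g
  proof -
    obtain d where "cmod d = 1" "\<And>z. z \<in> annulus q \<Longrightarrow> g z = d * complex_of_real (sqrt q) / z"
      using deriv_sqrt_branch_reflection(2)[OF q c(1) _ g] c(2) by blast
    then show ?thesis
      using c by (intro law(1))
  qed
  moreover have "\<exists>g. deriv_sqrt_branch (annulus q) f g"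
    using deriv_sqrt_branch_reflection(1)[OF q c(1)] c(2) by blast
  moreover have "same_law_point_process M (annulus q)
      (\<lambda>\<omega>. pullback_measure (annulus q) f (zero_process q q \<zeta> \<omega>)) (zero_process q q \<zeta>)"
    by (rule law(2)[where c = c and d = 1 and g = "\<lambda>z. 1 * complex_of_real (sqrt q) / z"]) (simp_all add: c)
  ultimately show ?thesis
    by (simp add: invariant_GAF_def invariant_point_process_def)
qed

theorem proposition1p1:
  fixes M :: "'a measure" and \<zeta> :: "int \<Rightarrow> 'a \<Rightarrow> complex" and q r :: real
  assumes "0 < q" and "q < 1" and "0 < r"
    and "iid_std_complex_gaussian M \<zeta>"
  shows
    "same_law_process M (annulus q)
       (\<lambda>\<omega> z. inversion_deriv_sqrt q z * gaussian_laurent q r \<zeta> \<omega> (inversion q z))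
       (\<lambda>\<omega> z. complex_of_real (sqrt (q / r)) * gaussian_laurent q (q\<^sup>2 / r) \<zeta> \<omega> z)
     \<and> same_law_point_process M (annulus q)
         (\<lambda>\<omega>. pullback_measure (annulus q) (inversion q) (zero_process q r \<zeta> \<omega>))
         (zero_process q (q\<^sup>2 / r) \<zeta>)
     \<and> (\<forall>f. conformal_automorphism (annulus q) f \<longrightarrow>
           invariant_GAF M (annulus q) (gaussian_laurent q q \<zeta>) f \<and>
           invariant_point_process M (annulus q) (zero_process q q \<zeta>) f)"
proof -
  \<comment> \<open>Here c = 1 and d = i; the square of i supplies the minus sign in the derivative
    -q/z^2.\<close>
  note law = gaussian_laurent_reflection_law[OF assms conformal_automorphism_inversion[OF assms(1)],
      of 1 \<i> "inversion_deriv_sqrt q"]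
  show ?thesis
    using law gaussian_laurent_conformal_invariance[OF assms(1,2,4)]
    by (simp add: inversion_deriv_sqrt_def)
qed

end
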